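(* The theory $V^0(2)$ proves (the natural $\Sigma^B_0$-formalization of) the following statement, for all $n$: Let $B$ be a set of grid edges forming a curve, let $p_1,p_2$ be two grid points on different sides of $B$, and let $R$ be a set of grid edges that connects $p_1$ and $p_2$. Then $B$ and $R$ intersect.
   Context: Grid setting: fix a parameter $n$. A grid point is a pair $(x,y)$ of integers with $0\le x,y\le n$; write $x(p),y(p)$ for its coordinates. A (undirected) edge is a pair of adjacent grid points, i.e. points differing by exactly 1 in exactly one coordinate. For a set $E$ of edges, the $E$-degree of a point $p$ is the number of edges of $E$ incident to $p$. A curve is a nonempty set $E$ of edges such that every grid point has $E$-degree $0$ or $2$ (so it may consist of several disjoint closed curves). A set $E$ of edges connects points $p_1,p_2$ if $p_1$ and $p_2$ have $E$-degree 1 and every other grid point has $E$-degree $0$ or $2$. Two sets $E_1,E_2$ of edges intersect if some grid point has $E_1$-degree $\ge1$ and $E_2$-degree $\ge1$. Points $p_1,p_2$ are on different sides of $E$ if $x(p_1)=x(p_2)$, $|y(p_1)-y(p_2)|=2$, $p_1$ and $p_2$ have $E$-degree $0$, and the point $p$ with $x(p)=x(p_1)$, $y(p)=\frac12(y(p_1)+y(p_2))$ has $E$-degree $2$. Theories: $V^0$ is the two-sorted first-order theory (sorts: natural numbers, and finite subsets of $\mathbb N$ viewed as bit strings) over the vocabulary $0,1,+,\cdot,\le,=,|X|,\in$ (where $|X|$ is one plus the largest element of $X$, or $0$ if $X=\emptyset$), axiomatized by the basic axioms of these symbols (2-BASIC) together with the comprehension scheme $\exists X\le y\,\forall z<y\,(X(z)\leftrightarrow\varphi(z))$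 for every $\Sigma^B_0$ formula $\varphi$ not containing $X$ ($\Sigma^B_0$ formulas: all number quantifiers bounded, no set quantifiers). $V^0(2)$ is $V^0$ plus the axiom $\exists Y\,[\neg Y(0)\wedge\forall z<x\,(Y(z+1)\leftrightarrow (Y(z)\oplus X(z)))]$ (existence of parity vectors). Points and edges are coded as numbers via a pairing function, and sets of edges as finite sets of numbers. *)

theory Defs
  imports Main
begin

section \<open>Two-sorted first-order logic over the vocabulary 0, 1, +, *, <=, =, |X|, membership\<close>

text \<open>
  Variables of both sorts are de Bruijn indices, counted separately for the two sorts: a number
  quantifier shifts only number indices, a set quantifier only set indices.  The only terms of set
  sort are variables.
\<close>

datatype tm =
    NVar nat
  | Zero
  | One
  | Plus tm tm
  | Times tm tm
  | Len nat

datatype fm =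
    Falsum
  | NEq tm tm
  | SEq nat nat
  | Leq tm tm
  | Mem tm nat      \<comment> \<open>\<open>Mem t X\<close> is \<open>X(t)\<close>\<close>
  | Imp fm fm
  | NAll fm
  | SAll fm

subsection \<open>Simultaneous substitution\<close>

primrec tsub :: "(nat \<Rightarrow> tm) \<Rightarrow> (nat \<Rightarrow> nat) \<Rightarrow> tm \<Rightarrow> tm" where
  "tsub \<sigma> \<tau> (NVar i) = \<sigma> i"
| "tsub \<sigma> \<tau> Zero = Zero"
| "tsub \<sigma> \<tau> One = One"
| "tsub \<sigma> \<tau> (Plus s t) = Plus (tsub \<sigma> \<tau> s) (tsub \<sigma> \<tau> t)"
| "tsub \<sigma> \<tau> (Times s t) = Times (tsub \<sigma> \<tau> s) (tsub \<sigma> \<tau> t)"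
| "tsub \<sigma> \<tau> (Len X) = Len (\<tau> X)"

abbreviation nlift :: "tm \<Rightarrow> tm" where
  "nlift \<equiv> tsub (\<lambda>i. NVar (Suc i)) id"

abbreviation slift :: "tm \<Rightarrow> tm" where
  "slift \<equiv> tsub NVar Suc"

primrec fsub :: "(nat \<Rightarrow> tm) \<Rightarrow> (nat \<Rightarrow> nat) \<Rightarrow> fm \<Rightarrow> fm" where
  "fsub \<sigma> \<tau> Falsum = Falsum"
| "fsub \<sigma> \<tau> (NEq s t) = NEq (tsub \<sigma> \<tau> s) (tsub \<sigma> \<tau> t)"
| "fsub \<sigma> \<tau> (SEq X Y) = SEq (\<tau> X) (\<tau> Y)"
| "fsub \<sigma> \<tau> (Leq s t) = Leq (tsub \<sigma> \<tau> s) (tsub \<sigma> \<tau> t)"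
| "fsub \<sigma> \<tau> (Mem t X) = Mem (tsub \<sigma> \<tau> t) (\<tau> X)"
| "fsub \<sigma> \<tau> (Imp \<phi> \<psi>) = Imp (fsub \<sigma> \<tau> \<phi>) (fsub \<sigma> \<tau> \<psi>)"
| "fsub \<sigma> \<tau> (NAll \<phi>) = NAll (fsub (case_nat (NVar 0) (\<lambda>i. nlift (\<sigma> i))) \<tau> \<phi>)"
| "fsub \<sigma> \<tau> (SAll \<phi>) = SAll (fsub (\<lambda>i. slift (\<sigma> i)) (case_nat 0 (\<lambda>i. Suc (\<tau> i))) \<phi>)"

abbreviation nliftf :: "fm \<Rightarrow> fm" where
  "nliftf \<equiv> fsub (\<lambda>i. NVar (Suc i)) id"

abbreviation sliftf :: "fm \<Rightarrow> fm" where
  "sliftf \<equiv> fsub NVar Suc"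

abbreviation ninst :: "tm \<Rightarrow> fm \<Rightarrow> fm" where
  "ninst t \<equiv> fsub (case_nat t NVar) id"

abbreviation sinst :: "nat \<Rightarrow> fm \<Rightarrow> fm" where
  "sinst Y \<equiv> fsub NVar (case_nat Y id)"

subsection \<open>Derived connectives and quantifiers\<close>

definition Neg :: "fm \<Rightarrow> fm" where "Neg \<phi> = Imp \<phi> Falsum"
definition Con :: "fm \<Rightarrow> fm \<Rightarrow> fm" (infixr "\<^bold>\<and>" 65) where "\<phi> \<^bold>\<and> \<psi> = Neg (Imp \<phi> (Neg \<psi>))"
definition Dis :: "fm \<Rightarrow> fm \<Rightarrow> fm" (infixr "\<^bold>\<or>" 60) where "\<phi> \<^bold>\<or> \<psi> = Imp (Neg \<phi>) \<psi>"
definition Iff :: "fm \<Rightarrow> fm \<Rightarrow> fm" where "Iff \<phi> \<psi> = (Imp \<phi> \<psi> \<^bold>\<and> Imp \<psi> \<phi>)"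
definition Xor :: "fm \<Rightarrow> fm \<Rightarrow> fm" where "Xor \<phi> \<psi> = Neg (Iff \<phi> \<psi>)"
definition SEx :: "fm \<Rightarrow> fm" where "SEx \<phi> = Neg (SAll (Neg \<phi>))"
definition Less :: "tm \<Rightarrow> tm \<Rightarrow> fm" where "Less s t = (Leq s t \<^bold>\<and> Neg (NEq s t))"

text \<open>
  \<open>x \<le> t\<close> and \<open>x < t\<close> bounded quantifiers; \<open>nlift t\<close> makes sure that \<open>t\<close> does not contain the
  quantified variable, which is \<open>NVar 0\<close> in \<open>\<phi>\<close>.
\<close>

definition BAll :: "tm \<Rightarrow> fm \<Rightarrow> fm" where "BAll t \<phi> = NAll (Imp (Leq (NVar 0) (nlift t)) \<phi>)"
definition BEx :: "tm \<Rightarrow> fm \<Rightarrow> fm" where "BEx t \<phi> = Neg (BAll t (Neg \<phi>))"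
definition BAll_less :: "tm \<Rightarrow> fm \<Rightarrow> fm" where "BAll_less t \<phi> = NAll (Imp (Less (NVar 0) (nlift t)) \<phi>)"

inductive SigmaB0 :: "fm \<Rightarrow> bool" where
  "SigmaB0 Falsum"
| "SigmaB0 (NEq s t)"
| "SigmaB0 (SEq X Y)"
| "SigmaB0 (Leq s t)"
| "SigmaB0 (Mem t X)"
| "SigmaB0 \<phi> \<Longrightarrow> SigmaB0 \<psi> \<Longrightarrow> SigmaB0 (Imp \<phi> \<psi>)"
| "SigmaB0 \<phi> \<Longrightarrow> SigmaB0 (BAll t \<phi>)"

section \<open>Provability\<close>

text \<open>
  Classical natural deduction with equality in both sorts.  The list \<open>\<Gamma>\<close> holds the open
  assumptions, whose free variables are fixed.  The members of \<open>T\<close> are non-logical axioms; as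
  usual, an axiom with free variables stands for its universal closure, and accordingly rule \<open>Ax\<close>
  imposes no eigenvariable condition on them.
\<close>

inductive derives :: "fm set \<Rightarrow> fm list \<Rightarrow> fm \<Rightarrow> bool" for T :: "fm set" where
  Ax: "\<phi> \<in> T \<Longrightarrow> derives T \<Gamma> \<phi>"
| Assm: "\<phi> \<in> set \<Gamma> \<Longrightarrow> derives T \<Gamma> \<phi>"
| ImpI: "derives T (\<phi> # \<Gamma>) \<psi> \<Longrightarrow> derives T \<Gamma> (Imp \<phi> \<psi>)"
| ImpE: "derives T \<Gamma> (Imp \<phi> \<psi>) \<Longrightarrow> derives T \<Gamma> \<phi> \<Longrightarrow> derives T \<Gamma> \<psi>"
| Contr: "derives T (Neg \<phi> # \<Gamma>) Falsum \<Longrightarrow> derives T \<Gamma> \<phi>"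
| NAllI: "derives T (map nliftf \<Gamma>) \<phi> \<Longrightarrow> derives T \<Gamma> (NAll \<phi>)"
| NAllE: "derives T \<Gamma> (NAll \<phi>) \<Longrightarrow> derives T \<Gamma> (ninst t \<phi>)"
| SAllI: "derives T (map sliftf \<Gamma>) \<phi> \<Longrightarrow> derives T \<Gamma> (SAll \<phi>)"
| SAllE: "derives T \<Gamma> (SAll \<phi>) \<Longrightarrow> derives T \<Gamma> (sinst Y \<phi>)"
| NRefl: "derives T \<Gamma> (NEq t t)"
| NSubst: "derives T \<Gamma> (NEq s t) \<Longrightarrow> derives T \<Gamma> (ninst s \<phi>) \<Longrightarrow> derives T \<Gamma> (ninst t \<phi>)"
| SRefl: "derives T \<Gamma> (SEq X X)"
| SSubst: "derives T \<Gamma> (SEq X Y) \<Longrightarrow> derives T \<Gamma> (sinst X \<phi>) \<Longrightarrow> derives T \<Gamma> (sinst Y \<phi>)"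

definition proves :: "fm set \<Rightarrow> fm \<Rightarrow> bool" (infix "\<turnstile>" 55) where
  "T \<turnstile> \<phi> \<longleftrightarrow> derives T [] \<phi>"

section \<open>The theory V0(2)\<close>

text \<open>The axioms B1--B12, L1, L2 and SE (extensionality) of Cook and Nguyen, in this order;
  \<open>x < y\<close> abbreviates \<open>x \<le> y \<and> x \<noteq> y\<close>.\<close>

definition BASIC2 :: "fm set" where
  "BASIC2 = (let x = NVar 0; y = NVar 1; X = 0; Y = 1 in
   { Neg (NEq (Plus x One) Zero),
     Imp (NEq (Plus x One) (Plus y One)) (NEq x y),
     NEq (Plus x Zero) x,
     NEq (Plus x (Plus y One)) (Plus (Plus x y) One),
     NEq (Times x Zero) Zero,
     NEq (Times x (Plus y One)) (Plus (Times x y) x),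
     Imp (Leq x y \<^bold>\<and> Leq y x) (NEq x y),
     Leq x (Plus x y),
     Leq Zero x,
     Leq x y \<^bold>\<or> Leq y x,
     Iff (Leq x y) (Less x (Plus y One)),
     Imp (Neg (NEq x Zero)) (BEx x (NEq (Plus (NVar 0) One) (nlift x))),
     Imp (Mem y X) (Less y (Len X)),
     Imp (NEq (Plus y One) (Len X)) (Mem y X),
     Imp (NEq (Len X) (Len Y) \<^bold>\<and> BAll_less (Len X) (Iff (Mem (NVar 0) X) (Mem (NVar 0) Y)))
         (SEq X Y) })"

text \<open>
  Comprehension: in \<open>\<phi>\<close>, \<open>NVar 0\<close> is \<open>z\<close>, \<open>NVar 1\<close> is the bound \<open>y\<close>, and all other free variables of
  either sort are parameters; \<open>sliftf\<close> ensures that \<open>X\<close> does not occur in \<open>\<phi>\<close>.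
\<close>

definition comprehension :: "fm \<Rightarrow> fm" where
  "comprehension \<phi> =
     SEx (Leq (Len 0) (NVar 0) \<^bold>\<and>
          BAll_less (NVar 0) (Iff (Mem (NVar 0) 0) (sliftf \<phi>)))"

text \<open>Parity vectors: the parameters are \<open>x\<close> (\<open>NVar 0\<close>) and \<open>X\<close>, which is set variable 1 under the quantifier of \<open>Y\<close>.\<close>

definition parity_axiom :: fm where
  "parity_axiom =
     SEx (Neg (Mem Zero 0) \<^bold>\<and>
          BAll_less (NVar 0)
            (Iff (Mem (Plus (NVar 0) One) 0) (Xor (Mem (NVar 0) 0) (Mem (NVar 0) 1))))"

definition V0 :: "fm set" where
  "V0 = BASIC2 \<union> {comprehension \<phi> | \<phi>. SigmaB0 \<phi>}"

definition V0_2 :: "fm set" where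
  "V0_2 = insert parity_axiom V0"

section \<open>Grid edges and curves as formulas\<close>

definition Two :: tm where "Two = Plus One One"

definition pair :: "tm \<Rightarrow> tm \<Rightarrow> tm" where
  "pair x y = Plus (Times (Plus x y) (Plus (Plus x y) One)) (Times Two y)"

text \<open>
  In what follows \<open>n\<close> is the grid parameter, \<open>p\<close>, \<open>q\<close> are codes of points, \<open>e\<close> codes of edges, and \<open>E\<close>
  is a set variable.
\<close>

definition is_point :: "tm \<Rightarrow> tm \<Rightarrow> fm" where
  "is_point n p =
     BEx n (BEx (nlift n) (NEq (nlift (nlift p)) (pair (NVar 1) (NVar 0))))"

definition differ_by_one :: "tm \<Rightarrow> tm \<Rightarrow> fm" where
  "differ_by_one s t = (NEq s (Plus t One) \<^bold>\<or> NEq t (Plus s One))"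

text \<open>
  The bound variables are the coordinates of \<open>p = (NVar 3, NVar 2)\<close> and \<open>q = (NVar 1, NVar 0)\<close>.
\<close>

definition adjacent :: "tm \<Rightarrow> tm \<Rightarrow> tm \<Rightarrow> fm" where
  "adjacent n p q = (let n1 = nlift n; n2 = nlift n1; n3 = nlift n2 in
     BEx n (BEx n1 (BEx n2 (BEx n3
      (NEq (nlift (nlift (nlift (nlift p)))) (pair (NVar 3) (NVar 2)) \<^bold>\<and>
       NEq (nlift (nlift (nlift (nlift q)))) (pair (NVar 1) (NVar 0)) \<^bold>\<and>
       ((NEq (NVar 3) (NVar 1) \<^bold>\<and> differ_by_one (NVar 2) (NVar 0)) \<^bold>\<or>
        (NEq (NVar 2) (NVar 0) \<^bold>\<and> differ_by_one (NVar 3) (NVar 1))))))))"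

text \<open>
  The undirected edge between \<open>p\<close> and \<open>q\<close> is coded by \<open>pair p q\<close> where \<open>p < q\<close>, so that every edge
  has exactly one code.
\<close>

definition is_edge :: "tm \<Rightarrow> tm \<Rightarrow> fm" where
  "is_edge n e =
     BEx e (BEx (nlift e)
      (NEq (nlift (nlift e)) (pair (NVar 1) (NVar 0)) \<^bold>\<and>
       Less (NVar 1) (NVar 0) \<^bold>\<and>
       adjacent (nlift (nlift n)) (NVar 1) (NVar 0)))"

definition edge_set :: "tm \<Rightarrow> nat \<Rightarrow> fm" where
  "edge_set n E = BAll (Len E) (Imp (Mem (NVar 0) E) (is_edge (nlift n) (NVar 0)))"

definition nonempty :: "nat \<Rightarrow> fm" where
  "nonempty E = BEx (Len E) (Mem (NVar 0) E)"

definition incident :: "nat \<Rightarrow> tm \<Rightarrow> tm \<Rightarrow> fm" where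
  "incident E e p =
     (Mem e E \<^bold>\<and>
      BEx e (NEq (nlift e) (pair (nlift p) (NVar 0)) \<^bold>\<or>
             NEq (nlift e) (pair (NVar 0) (nlift p))))"

definition deg_ge1 :: "nat \<Rightarrow> tm \<Rightarrow> fm" where
  "deg_ge1 E p = BEx (Len E) (incident E (NVar 0) (nlift p))"

definition deg0 :: "nat \<Rightarrow> tm \<Rightarrow> fm" where
  "deg0 E p = Neg (deg_ge1 E p)"

definition deg1 :: "nat \<Rightarrow> tm \<Rightarrow> fm" where
  "deg1 E p =
     BEx (Len E)
      (incident E (NVar 0) (nlift p) \<^bold>\<and>
       BAll (Len E)
        (Imp (incident E (NVar 0) (nlift (nlift p))) (NEq (NVar 0) (NVar 1))))"

definition deg2 :: "nat \<Rightarrow> tm \<Rightarrow> fm" where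
  "deg2 E p =
     BEx (Len E) (BEx (Len E)
      (Neg (NEq (NVar 1) (NVar 0)) \<^bold>\<and>
       incident E (NVar 1) (nlift (nlift p)) \<^bold>\<and>
       incident E (NVar 0) (nlift (nlift p)) \<^bold>\<and>
       BAll (Len E)
        (Imp (incident E (NVar 0) (nlift (nlift (nlift p))))
             (NEq (NVar 0) (NVar 2) \<^bold>\<or> NEq (NVar 0) (NVar 1)))))"

definition curve :: "tm \<Rightarrow> nat \<Rightarrow> fm" where
  "curve n E =
     (nonempty E \<^bold>\<and>
      BAll n (BAll (nlift n)
       (deg0 E (pair (NVar 1) (NVar 0)) \<^bold>\<or> deg2 E (pair (NVar 1) (NVar 0)))))"

definition connects :: "tm \<Rightarrow> nat \<Rightarrow> tm \<Rightarrow> tm \<Rightarrow> fm" where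
  "connects n E p\<^sub>1 p\<^sub>2 =
     (deg1 E p\<^sub>1 \<^bold>\<and> deg1 E p\<^sub>2 \<^bold>\<and>
      BAll n (BAll (nlift n)
       (Imp (Neg (NEq (pair (NVar 1) (NVar 0)) (nlift (nlift p\<^sub>1))) \<^bold>\<and>
             Neg (NEq (pair (NVar 1) (NVar 0)) (nlift (nlift p\<^sub>2))))
            (deg0 E (pair (NVar 1) (NVar 0)) \<^bold>\<or> deg2 E (pair (NVar 1) (NVar 0))))))"

definition intersect :: "tm \<Rightarrow> nat \<Rightarrow> nat \<Rightarrow> fm" where
  "intersect n E\<^sub>1 E\<^sub>2 =
     BEx n (BEx (nlift n)
      (deg_ge1 E\<^sub>1 (pair (NVar 1) (NVar 0)) \<^bold>\<and> deg_ge1 E\<^sub>2 (pair (NVar 1) (NVar 0))))"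

text \<open>
  The coordinates are \<open>p\<^sub>1 = (NVar 4, NVar 3)\<close> and \<open>p\<^sub>2 = (NVar 2, NVar 1)\<close>, and \<open>NVar 0\<close> is the second
  coordinate of the midpoint.
\<close>

definition different_sides :: "tm \<Rightarrow> nat \<Rightarrow> tm \<Rightarrow> tm \<Rightarrow> fm" where
  "different_sides n E p\<^sub>1 p\<^sub>2 =
     (let lift5 = (\<lambda>t. nlift (nlift (nlift (nlift (nlift t)))));
          n1 = nlift n; n2 = nlift n1; n3 = nlift n2; n4 = nlift n3 in
      BEx n (BEx n1 (BEx n2 (BEx n3 (BEx n4
       (NEq (lift5 p\<^sub>1) (pair (NVar 4) (NVar 3)) \<^bold>\<and>
        NEq (lift5 p\<^sub>2) (pair (NVar 2) (NVar 1)) \<^bold>\<and>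
        NEq (NVar 4) (NVar 2) \<^bold>\<and>
        (NEq (NVar 3) (Plus (NVar 1) Two) \<^bold>\<or> NEq (NVar 1) (Plus (NVar 3) Two)) \<^bold>\<and>
        deg0 E (lift5 p\<^sub>1) \<^bold>\<and> deg0 E (lift5 p\<^sub>2) \<^bold>\<and>
        NEq (Times Two (NVar 0)) (Plus (NVar 3) (NVar 1)) \<^bold>\<and>
        deg2 E (pair (NVar 4) (NVar 0))))))))"

definition jordan_main :: "tm \<Rightarrow> tm \<Rightarrow> tm \<Rightarrow> nat \<Rightarrow> nat \<Rightarrow> fm" where
  "jordan_main n p\<^sub>1 p\<^sub>2 B R =
     Imp (edge_set n B \<^bold>\<and> curve n B \<^bold>\<and>
          is_point n p\<^sub>1 \<^bold>\<and> is_point n p\<^sub>2 \<^bold>\<and> different_sides n B p\<^sub>1 p\<^sub>2 \<^bold>\<and>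
          edge_set n R \<^bold>\<and> connects n R p\<^sub>1 p\<^sub>2)
         (intersect n B R)"

lemma SigmaB0_Neg: "SigmaB0 \<phi> \<Longrightarrow> SigmaB0 (Neg \<phi>)"
  by (auto simp: Neg_def intro: SigmaB0.intros)

lemma SigmaB0_Con: "SigmaB0 \<phi> \<Longrightarrow> SigmaB0 \<psi> \<Longrightarrow> SigmaB0 (\<phi> \<^bold>\<and> \<psi>)"
  by (auto simp: Con_def Neg_def intro: SigmaB0.intros)

lemma SigmaB0_Dis: "SigmaB0 \<phi> \<Longrightarrow> SigmaB0 \<psi> \<Longrightarrow> SigmaB0 (\<phi> \<^bold>\<or> \<psi>)"
  by (auto simp: Dis_def Neg_def intro: SigmaB0.intros)

lemma SigmaB0_BEx: "SigmaB0 \<phi> \<Longrightarrow> SigmaB0 (BEx t \<phi>)"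
  by (auto simp: BEx_def Neg_def intro: SigmaB0.intros)

lemma SigmaB0_jordan_main: "SigmaB0 (jordan_main n p\<^sub>1 p\<^sub>2 B R)"
  unfolding jordan_main_def different_sides_def intersect_def connects_def curve_def deg2_def
    deg1_def deg0_def deg_ge1_def incident_def nonempty_def edge_set_def is_edge_def adjacent_def
    differ_by_one_def is_point_def Less_def Let_def
  by (intro SigmaB0.intros SigmaB0_Neg SigmaB0_Con SigmaB0_Dis SigmaB0_BEx)

end

theory Submission
  imports Defs "HOL-Library.Countable_Set"
begin

text \<open>
  By the completeness theorem it is enough to work in a model of \<open>V0_2\<close>.  Let \<open>w(x, y)\<close> be the parity
  of the number of edges of \<open>B\<close> between the columns \<open>x - 1\<close> and \<open>x\<close> below height \<open>y\<close>.  As all degrees in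
  \<open>B\<close> are even, \<open>w\<close> does not change along a grid edge that starts at a point not on \<open>B\<close>, while it differs at
  the two points on different sides of \<open>B\<close>.  If \<open>R\<close> misses \<open>B\<close>, the edges of \<open>R\<close> on which \<open>w\<close> holds therefore
  have exactly one vertex of odd degree, say in column \<open>a\<close>.  Summing degrees column by column, the number
  of these edges between the columns \<open>x - 1\<close> and \<open>x\<close> is even for \<open>x \<le> a\<close> and odd for \<open>x > a\<close>, although
  there are no edges beyond the last column.  Only parities along columns and induction on
  bounded (\<open>SigmaB0\<close>) formulas are used.
\<close>

section \<open>Substitution\<close>

text \<open>The function \<open>w\<close> is ray casting: a downward ray from \<open>(x, y)\<close>,
  moved half a column to the left so that it can meet only horizontal edges, is followed and its
  crossings with \<open>B\<close> are counted modulo 2. The side of a point is thus read off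
  locally, without any notion of region or component. What shapes the proof is that models may be
  nonstandard: a parity exists only if the parity axiom supplies it, and induction is available only
  for bounded formulas. Since \<open>w\<close> comes from a parity vector, it can enter as a set
  parameter, so that being an edge of \<open>R\<close> on which \<open>w\<close> holds is again a
  bounded property and a second parity vector can be taken for these edges. These are the only two
  uses of the parity axiom, and the order matters, as the second vector is built from the first.
  Everything else is a recursion of xors along a column, and each induction comes with a proof that
  its predicate is definable.\<close>

lemma tsub_tsub: "tsub \<sigma> \<tau> (tsub \<sigma>' \<tau>' t) = tsub (\<lambda>i. tsub \<sigma> \<tau> (\<sigma>' i)) (\<lambda>i. \<tau> (\<tau>' i)) t"
  by (induction t) auto

lemma tsub_NVar [simp]: "tsub NVar id t = t" "tsub NVar (\<lambda>i. i) t = t"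
  by (induction t) auto

lemma fsub_fsub: "fsub \<sigma> \<tau> (fsub \<sigma>' \<tau>' \<phi>) = fsub (\<lambda>i. tsub \<sigma> \<tau> (\<sigma>' i)) (\<lambda>i. \<tau> (\<tau>' i)) \<phi>"
proof (induction \<phi> arbitrary: \<sigma> \<tau> \<sigma>' \<tau>')
  case (NAll \<phi>)
  have "(\<lambda>i. tsub (case_nat (NVar 0) (\<lambda>i. nlift (\<sigma> i))) \<tau> (case_nat (NVar 0) (\<lambda>i. nlift (\<sigma>' i)) i))
      = case_nat (NVar 0) (\<lambda>i. nlift (tsub \<sigma> \<tau> (\<sigma>' i)))"
    by (rule ext) (auto simp: tsub_tsub split: nat.split)
  then show ?case by (simp add: NAll)
next
  case (SAll \<phi>)
  have "(\<lambda>i. case_nat 0 (\<lambda>i. Suc (\<tau> i)) (case_nat 0 (\<lambda>i. Suc (\<tau>' i)) i))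
      = case_nat 0 (\<lambda>i. Suc (\<tau> (\<tau>' i)))"
    by (rule ext) (auto split: nat.split)
  then show ?case by (simp add: SAll tsub_tsub)
qed (auto simp: tsub_tsub)

lemma fsub_NVar [simp]: "fsub NVar id \<phi> = \<phi>"
proof (induction \<phi>)
  case (NAll \<phi>)
  have "case_nat (NVar 0) (\<lambda>i. nlift (NVar i)) = NVar"
    by (rule ext) (auto split: nat.split)
  then show ?case using NAll by simp
next
  case (SAll \<phi>)
  have "case_nat 0 (\<lambda>i. Suc (id i)) = id"
    by (rule ext) (auto split: nat.split)
  then show ?case using SAll by (simp add: id_def)
qed auto

lemma fsub_NVar' [simp]: "fsub NVar (\<lambda>i. i) \<phi> = \<phi>"
  using fsub_NVar by (simp only: id_def)

lemma tsub_cong_bounded: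
  "\<exists>N. \<forall>\<sigma> \<sigma>' \<tau> \<tau>'. (\<forall>i<N. \<sigma> i = \<sigma>' i \<and> \<tau> i = \<tau>' i) \<longrightarrow> tsub \<sigma> \<tau> t = tsub \<sigma>' \<tau>' t"
proof (induction t)
  case (NVar x)
  show ?case by (intro exI[of _ "Suc x"]) auto
next
  case (Len x)
  show ?case by (intro exI[of _ "Suc x"]) auto
next
  case (Plus s t)
  then obtain N N' where
    "\<forall>\<sigma> \<sigma>' \<tau> \<tau>'. (\<forall>i<N. \<sigma> i = \<sigma>' i \<and> \<tau> i = \<tau>' i) \<longrightarrow> tsub \<sigma> \<tau> s = tsub \<sigma>' \<tau>' s"
    "\<forall>\<sigma> \<sigma>' \<tau> \<tau>'. (\<forall>i<N'. \<sigma> i = \<sigma>' i \<and> \<tau> i = \<tau>' i) \<longrightarrow> tsub \<sigma> \<tau> t = tsub \<sigma>' \<tau>' t"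
    by blast
  then show ?case by (intro exI[of _ "max N N'"]) auto
next
  case (Times s t)
  then obtain N N' where
    "\<forall>\<sigma> \<sigma>' \<tau> \<tau>'. (\<forall>i<N. \<sigma> i = \<sigma>' i \<and> \<tau> i = \<tau>' i) \<longrightarrow> tsub \<sigma> \<tau> s = tsub \<sigma>' \<tau>' s"
    "\<forall>\<sigma> \<sigma>' \<tau> \<tau>'. (\<forall>i<N'. \<sigma> i = \<sigma>' i \<and> \<tau> i = \<tau>' i) \<longrightarrow> tsub \<sigma> \<tau> t = tsub \<sigma>' \<tau>' t"
    by blast
  then show ?case by (intro exI[of _ "max N N'"]) auto
qed auto

text \<open>A substitutional way to say that the free variables of both sorts lie below
  \<open>N\<close>; it is exactly the form in which freshness is used later, and no recursion on
  free variables is needed.\<close>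

definition depends_below :: "nat \<Rightarrow> fm \<Rightarrow> bool" where
  "depends_below N \<phi> \<longleftrightarrow> (\<forall>\<sigma> \<sigma>' \<tau> \<tau>'.
     (\<forall>i<N. \<sigma> i = \<sigma>' i \<and> \<tau> i = \<tau>' i) \<longrightarrow> fsub \<sigma> \<tau> \<phi> = fsub \<sigma>' \<tau>' \<phi>)"

lemma depends_belowD:
  "depends_below N \<phi> \<Longrightarrow> (\<And>i. i < N \<Longrightarrow> \<sigma> i = \<sigma>' i) \<Longrightarrow> (\<And>i. i < N \<Longrightarrow> \<tau> i = \<tau>' i)
    \<Longrightarrow> fsub \<sigma> \<tau> \<phi> = fsub \<sigma>' \<tau>' \<phi>"
  unfolding depends_below_def by blast

lemma depends_below_mono: "depends_below N \<phi> \<Longrightarrow> N \<le> N' \<Longrightarrow> depends_below N' \<phi>"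
  unfolding depends_below_def by (meson order_less_le_trans)

lemma depends_below_tm2:
  "\<exists>N. \<forall>\<sigma> \<sigma>' \<tau> \<tau>'. (\<forall>i<N. \<sigma> i = \<sigma>' i \<and> \<tau> i = \<tau>' i) \<longrightarrow>
     tsub \<sigma> \<tau> s = tsub \<sigma>' \<tau>' s \<and> tsub \<sigma> \<tau> t = tsub \<sigma>' \<tau>' t"
  using tsub_cong_bounded[of "Plus s t"] by simp

lemma depends_below_ex: "\<exists>N. depends_below N \<phi>"
proof (induction \<phi>)
  case (NEq s t)
  show ?case using depends_below_tm2[of s t] unfolding depends_below_def by simp
next
  case (Leq s t)
  show ?case using depends_below_tm2[of s t] unfolding depends_below_def by simp
next
  case (SEq X Y)
  show ?case unfolding depends_below_def by (intro exI[of _ "Suc (max X Y)"]) auto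
next
  case (Mem t X)
  show ?case using depends_below_tm2[of t "Len X"] unfolding depends_below_def by simp
next
  case (Imp \<phi> \<psi>)
  then obtain N N' where N: "depends_below N \<phi>" "depends_below N' \<psi>" by blast
  then have "depends_below (max N N') \<phi>" "depends_below (max N N') \<psi>"
    by (auto elim: depends_below_mono)
  then have "depends_below (max N N') (Imp \<phi> \<psi>)"
    unfolding depends_below_def by auto
  then show ?case by blast
next
  case (NAll \<phi>)
  then obtain N where N: "depends_below N \<phi>" by blast
  have "depends_below N (NAll \<phi>)"
    unfolding depends_below_def
    by (auto intro!: depends_belowD[OF N] split: nat.split)
  then show ?case by blast
next
  case (SAll \<phi>)
  then obtain N where N: "depends_below N \<phi>" by blast
  have "depends_below N (SAll \<phi>)"
    unfolding depends_below_def
    by (auto intro!: depends_belowD[OF N] split: nat.split)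
  then show ?case by blast
qed (simp add: depends_below_def)

lemma depends_below_list: "\<exists>N. \<forall>\<phi>\<in>set \<Gamma>. depends_below N \<phi>"
proof (induction \<Gamma>)
  case (Cons \<phi> \<Gamma>)
  obtain N N' where "depends_below N \<phi>" "\<forall>\<phi>\<in>set \<Gamma>. depends_below N' \<phi>"
    using Cons depends_below_ex by blast
  then have "\<forall>\<psi>\<in>set (\<phi> # \<Gamma>). depends_below (max N N') \<psi>"
    by (auto intro: depends_below_mono)
  then show ?case by blast
qed simp

section \<open>Derivability\<close>

lemma derives_weaken: "derives T \<Gamma> \<phi> \<Longrightarrow> set \<Gamma> \<subseteq> set \<Delta> \<Longrightarrow> derives T \<Delta> \<phi>"
proof (induction arbitrary: \<Delta> rule: derives.induct)
  case (ImpI \<phi> \<Gamma> \<psi>)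
  have "derives T (\<phi> # \<Delta>) \<psi>" by (rule ImpI.IH) (use ImpI.prems in auto)
  then show ?case by (rule derives.ImpI)
next
  case (Contr \<phi> \<Gamma>)
  have "derives T (Neg \<phi> # \<Delta>) Falsum" by (rule Contr.IH) (use Contr.prems in auto)
  then show ?case by (rule derives.Contr)
next
  case (NAllI \<Gamma> \<phi>)
  have "derives T (map nliftf \<Delta>) \<phi>" by (rule NAllI.IH) (use NAllI.prems in auto)
  then show ?case by (rule derives.NAllI)
next
  case (SAllI \<Gamma> \<phi>)
  have "derives T (map sliftf \<Delta>) \<phi>" by (rule SAllI.IH) (use SAllI.prems in auto)
  then show ?case by (rule derives.SAllI)
next
  case (Assm \<phi> \<Gamma>)
  then show ?case by (auto intro: derives.Assm)
qed (blast intro: derives.intros)+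

text \<open>The terms already substituted are shifted out of the way of the later instantiations.\<close>

lemma derives_nsubst_initial:
  "derives T [] \<phi> \<Longrightarrow> derives T [] (fsub (\<lambda>i. if i < N then \<sigma> i else NVar (i - N)) id \<phi>)"
proof (induction N arbitrary: \<phi> \<sigma>)
  case 0
  then show ?case by simp
next
  case (Suc N)
  let ?t = "tsub (\<lambda>i. NVar (i + N)) id (\<sigma> 0)"
  have "derives T [] (NAll \<phi>)" using Suc.prems by (auto intro: derives.NAllI)
  then have "derives T [] (ninst ?t \<phi>)" by (rule derives.NAllE)
  from Suc.IH[OF this, of "\<lambda>i. \<sigma> (Suc i)"]
  show ?case
    unfolding fsub_fsub
    by (elim back_subst[of "derives T []"])
       (rule arg_cong[where f="\<lambda>\<rho>. fsub \<rho> _ _"] arg_cong2[where f="\<lambda>\<rho> \<tau>. fsub \<rho> \<tau> \<phi>"];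
        auto simp: fun_eq_iff tsub_tsub split: nat.split)
qed

lemma derives_ssubst_initial:
  "derives T [] \<phi> \<Longrightarrow> derives T [] (fsub NVar (\<lambda>i. if i < N then \<tau> i else i - N) \<phi>)"
proof (induction N arbitrary: \<phi> \<tau>)
  case 0
  then show ?case by simp
next
  case (Suc N)
  have "derives T [] (SAll \<phi>)" using Suc.prems by (auto intro: derives.SAllI)
  then have "derives T [] (sinst (\<tau> 0 + N) \<phi>)" by (rule derives.SAllE)
  from Suc.IH[OF this, of "\<lambda>i. \<tau> (Suc i)"]
  show ?case
    unfolding fsub_fsub
    by (elim back_subst[of "derives T []"])
       (rule arg_cong2[where f="\<lambda>\<rho> \<tau>. fsub \<rho> \<tau> \<phi>"];
        auto simp: fun_eq_iff split: nat.split)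
qed

text \<open>Induction on the derivation would fail at \<open>Ax\<close>, since \<open>T\<close> need
  not be closed under substitution. Without open assumptions, however, every variable can be
  generalised and then instantiated, and since a formula has finitely many variables, substitutions
  on an initial segment suffice.\<close>

lemma derives_subst_closed:
  assumes "derives T [] \<phi>"
  shows "derives T [] (fsub \<sigma> \<tau> \<phi>)"
proof -
  obtain N where N: "depends_below N \<phi>" using depends_below_ex by blast
  \<comment> \<open>Set variables come first: in the other order \<open>\<tau>\<close> would also
    rename the set variables inside the terms \<open>\<sigma> i\<close>.\<close>
  have "derives T [] (fsub NVar \<tau> \<phi>)"
    using derives_ssubst_initial[OF assms, of N \<tau>]
    by (elim back_subst[of "derives T []"]) (rule depends_belowD[OF N]; simp)
  moreover obtain N' where N': "depends_below N' (fsub NVar \<tau> \<phi>)" using depends_below_ex by blast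
  moreover have "fsub (\<lambda>i. if i < N' then \<sigma> i else NVar (i - N')) id (fsub NVar \<tau> \<phi>)
      = fsub \<sigma> id (fsub NVar \<tau> \<phi>)"
    by (rule depends_belowD[OF N']; simp)
  ultimately have "derives T [] (fsub \<sigma> id (fsub NVar \<tau> \<phi>))"
    using derives_nsubst_initial[of T "fsub NVar \<tau> \<phi>" N' \<sigma>] by (simp only:)
  then show ?thesis by (simp add: fsub_fsub)
qed

lemma derives_foldr_Imp: "derives T [] (foldr Imp \<Gamma> \<phi>) \<longleftrightarrow> derives T \<Gamma> \<phi>"
proof -
  have "derives T \<Delta> (foldr Imp \<Gamma> \<phi>) \<longleftrightarrow> derives T (rev \<Gamma> @ \<Delta>) \<phi>" for \<Delta>
  proof (induction \<Gamma> arbitrary: \<Delta>)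
    case (Cons \<psi> \<Gamma>)
    have "derives T \<Delta> (Imp \<psi> \<chi>) \<longleftrightarrow> derives T (\<psi> # \<Delta>) \<chi>" for \<chi>
      by (rule iffI, rule derives.ImpE[where \<phi> = \<psi>])
         (auto intro: derives.Assm derives.ImpI elim: derives_weaken)
    then show ?case using Cons by simp
  qed simp
  from this[of "[]"] show ?thesis by (auto elim: derives_weaken)
qed

lemma derives_subst:
  assumes "derives T \<Gamma> \<phi>"
  shows "derives T (map (fsub \<sigma> \<tau>) \<Gamma>) (fsub \<sigma> \<tau> \<phi>)"
proof -
  have "fsub \<sigma> \<tau> (foldr Imp \<Gamma> \<phi>) = foldr Imp (map (fsub \<sigma> \<tau>) \<Gamma>) (fsub \<sigma> \<tau> \<phi>)"
    by (induction \<Gamma>) auto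
  then show ?thesis
    using assms derives_subst_closed[of T "foldr Imp \<Gamma> \<phi>" \<sigma> \<tau>] by (simp add: derives_foldr_Imp)
qed

text \<open>The eigenvariable rule with a named fresh variable. Renaming \<open>k\<close> to 0 and
  shifting every other variable turns the assumptions into their lifts and the instance at
  \<open>k\<close> back into \<open>\<phi>\<close>, which is the premise of
  \<open>NAllI\<close>.\<close>

lemma NAll_fresh:
  assumes "derives T \<Gamma> (ninst (NVar k) \<phi>)"
    and \<Gamma>: "\<And>\<psi>. \<psi> \<in> set \<Gamma> \<Longrightarrow> depends_below k \<psi>" and \<phi>: "depends_below k \<phi>"
  shows "derives T \<Gamma> (NAll \<phi>)"
proof (rule derives.NAllI)
  let ?\<sigma> = "\<lambda>i. if i = k then NVar 0 else NVar (Suc i)"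
  have "map (fsub ?\<sigma> id) \<Gamma> = map nliftf \<Gamma>"
    by (intro map_cong refl depends_belowD[OF \<Gamma>]) auto
  moreover have "fsub ?\<sigma> id (ninst (NVar k) \<phi>) = fsub NVar id \<phi>"
    unfolding fsub_fsub by (rule depends_belowD[OF \<phi>]) (auto split: nat.split)
  ultimately show "derives T (map nliftf \<Gamma>) \<phi>"
    using derives_subst[OF assms(1), of ?\<sigma> id] by (simp only: fsub_NVar)
qed

lemma SAll_fresh:
  assumes "derives T \<Gamma> (sinst k \<phi>)"
    and \<Gamma>: "\<And>\<psi>. \<psi> \<in> set \<Gamma> \<Longrightarrow> depends_below k \<psi>" and \<phi>: "depends_below k \<phi>"
  shows "derives T \<Gamma> (SAll \<phi>)"
proof (rule derives.SAllI)
  let ?\<tau> = "\<lambda>i. if i = k then 0 else Suc i"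
  have "map (fsub NVar ?\<tau>) \<Gamma> = map sliftf \<Gamma>"
    by (intro map_cong refl depends_belowD[OF \<Gamma>]) auto
  moreover have "fsub NVar ?\<tau> (sinst k \<phi>) = fsub NVar id \<phi>"
    unfolding fsub_fsub by (rule depends_belowD[OF \<phi>]) (auto split: nat.split)
  ultimately show "derives T (map sliftf \<Gamma>) \<phi>"
    using derives_subst[OF assms(1), of NVar ?\<tau>] by (simp only: fsub_NVar)
qed

section \<open>Structures and completeness\<close>

text \<open>Equality of numbers is identity, so that arithmetic in a model can be done by rewriting.
  Equality of sets is a relation of its own; the set variables themselves can then serve as the sets
  of the term model, without a quotient.\<close>

record ('n, 's) struct =
  zero :: 'n
  one :: 'n
  add :: "'n \<Rightarrow> 'n \<Rightarrow> 'n"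
  mul :: "'n \<Rightarrow> 'n \<Rightarrow> 'n"
  len :: "'s \<Rightarrow> 'n"
  le :: "'n \<Rightarrow> 'n \<Rightarrow> bool"
  mem :: "'n \<Rightarrow> 's \<Rightarrow> bool"
  seq :: "'s \<Rightarrow> 's \<Rightarrow> bool"

primrec tmval :: "('n, 's) struct \<Rightarrow> (nat \<Rightarrow> 'n) \<Rightarrow> (nat \<Rightarrow> 's) \<Rightarrow> tm \<Rightarrow> 'n" where
  "tmval M v f (NVar i) = v i"
| "tmval M v f Zero = zero M"
| "tmval M v f One = one M"
| "tmval M v f (Plus s t) = add M (tmval M v f s) (tmval M v f t)"
| "tmval M v f (Times s t) = mul M (tmval M v f s) (tmval M v f t)"
| "tmval M v f (Len X) = len M (f X)"

primrec sat :: "('n, 's) struct \<Rightarrow> (nat \<Rightarrow> 'n) \<Rightarrow> (nat \<Rightarrow> 's) \<Rightarrow> fm \<Rightarrow> bool" where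
  "sat M v f Falsum \<longleftrightarrow> False"
| "sat M v f (NEq s t) \<longleftrightarrow> tmval M v f s = tmval M v f t"
| "sat M v f (SEq X Y) \<longleftrightarrow> seq M (f X) (f Y)"
| "sat M v f (Leq s t) \<longleftrightarrow> le M (tmval M v f s) (tmval M v f t)"
| "sat M v f (Mem t X) \<longleftrightarrow> mem M (tmval M v f t) (f X)"
| "sat M v f (Imp \<phi> \<psi>) \<longleftrightarrow> (sat M v f \<phi> \<longrightarrow> sat M v f \<psi>)"
| "sat M v f (NAll \<phi>) \<longleftrightarrow> (\<forall>a. sat M (case_nat a v) f \<phi>)"
| "sat M v f (SAll \<phi>) \<longleftrightarrow> (\<forall>A. sat M v (case_nat A f) \<phi>)"

lemma sat_connectives [simp]:
  "sat M v f (Neg \<phi>) \<longleftrightarrow> \<not> sat M v f \<phi>"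
  "sat M v f (\<phi> \<^bold>\<and> \<psi>) \<longleftrightarrow> sat M v f \<phi> \<and> sat M v f \<psi>"
  "sat M v f (\<phi> \<^bold>\<or> \<psi>) \<longleftrightarrow> sat M v f \<phi> \<or> sat M v f \<psi>"
  "sat M v f (Iff \<phi> \<psi>) \<longleftrightarrow> (sat M v f \<phi> \<longleftrightarrow> sat M v f \<psi>)"
  "sat M v f (Xor \<phi> \<psi>) \<longleftrightarrow> (sat M v f \<phi> \<noteq> sat M v f \<psi>)"
  "sat M v f (SEx \<phi>) \<longleftrightarrow> (\<exists>A. sat M v (case_nat A f) \<phi>)"
  "sat M v f (Less s t) \<longleftrightarrow> le M (tmval M v f s) (tmval M v f t) \<and> tmval M v f s \<noteq> tmval M v f t"
  by (auto simp: Neg_def Con_def Dis_def Iff_def Xor_def SEx_def Less_def)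

lemma tmval_tsub: "tmval M v f (tsub \<sigma> \<tau> t) = tmval M (\<lambda>i. tmval M v f (\<sigma> i)) (\<lambda>i. f (\<tau> i)) t"
  by (induction t) auto

lemma tmval_nlift [simp]: "tmval M (case_nat a v) f (nlift t) = tmval M v f t"
  by (simp add: tmval_tsub)

lemma sat_fsub: "sat M v f (fsub \<sigma> \<tau> \<phi>) \<longleftrightarrow> sat M (\<lambda>i. tmval M v f (\<sigma> i)) (\<lambda>i. f (\<tau> i)) \<phi>"
proof (induction \<phi> arbitrary: \<sigma> \<tau> v f)
  case (NAll \<phi>)
  have "(\<lambda>i. tmval M (case_nat a v) f (case_nat (NVar 0) (\<lambda>i. nlift (\<sigma> i)) i))
      = case_nat a (\<lambda>i. tmval M v f (\<sigma> i))" for a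
    by (rule ext) (simp split: nat.split)
  then show ?case by (simp add: NAll)
next
  case (SAll \<phi>)
  have "(\<lambda>i. case_nat A f (case_nat 0 (\<lambda>i. Suc (\<tau> i)) i)) = case_nat A (\<lambda>i. f (\<tau> i))" for A
    by (rule ext) (simp split: nat.split)
  moreover have "tmval M v (case_nat A f) (slift t) = tmval M v f t" for A t
    by (simp add: tmval_tsub)
  ultimately show ?case by (simp add: SAll)
qed (auto simp: tmval_tsub)

lemma sat_sliftf [simp]: "sat M v (case_nat A f) (sliftf \<phi>) \<longleftrightarrow> sat M v f \<phi>"
  by (simp add: sat_fsub)

lemma sat_bounded [simp]:
  "sat M v f (BAll t \<phi>) \<longleftrightarrow> (\<forall>a. le M a (tmval M v f t) \<longrightarrow> sat M (case_nat a v) f \<phi>)"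
  "sat M v f (BEx t \<phi>) \<longleftrightarrow> (\<exists>a. le M a (tmval M v f t) \<and> sat M (case_nat a v) f \<phi>)"
  "sat M v f (BAll_less t \<phi>) \<longleftrightarrow>
     (\<forall>a. le M a (tmval M v f t) \<and> a \<noteq> tmval M v f t \<longrightarrow> sat M (case_nat a v) f \<phi>)"
  by (auto simp: BAll_def BEx_def BAll_less_def)

section \<open>Extension of a consistent list to a Henkin set\<close>

instance tm :: countable by countable_datatype
instance fm :: countable by countable_datatype

definition consistent :: "fm set \<Rightarrow> fm list \<Rightarrow> bool" where
  "consistent T \<Gamma> \<longleftrightarrow> \<not> derives T \<Gamma> Falsum"

lemma derives_cut: "derives T \<Gamma> \<phi> \<Longrightarrow> derives T (\<phi> # \<Gamma>) \<psi> \<Longrightarrow> derives T \<Gamma> \<psi>"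
  by (metis derives.ImpI derives.ImpE)

text \<open>Maximality and the Henkin property in one condition: a rejected universal formula comes
  with a failing instance at a variable. Variables thus play the role of Henkin constants and the
  language stays as it is.\<close>

definition decides :: "fm set \<Rightarrow> fm \<Rightarrow> bool" where
  "decides H \<phi> \<longleftrightarrow> \<phi> \<in> H \<or> Neg \<phi> \<in> H
     \<and> (\<forall>\<psi>. \<phi> = NAll \<psi> \<longrightarrow> (\<exists>k. Neg (ninst (NVar k) \<psi>) \<in> H))
     \<and> (\<forall>\<psi>. \<phi> = SAll \<psi> \<longrightarrow> (\<exists>k. Neg (sinst k \<psi>) \<in> H))"

lemma decides_mono: "decides H \<phi> \<Longrightarrow> H \<subseteq> H' \<Longrightarrow> decides H' \<phi>"
  unfolding decides_def by blast

text \<open>A finite list leaves infinitely many variables fresh, so a counterexample to a rejected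
  universal formula can be named by one of them. Free variables of the axioms do no harm, because
  the axioms are not members of the list.\<close>

lemma consistent_decide:
  assumes con: "consistent T \<Gamma>"
  shows "\<exists>\<Delta>. consistent T \<Delta> \<and> set \<Gamma> \<subseteq> set \<Delta> \<and> decides (set \<Delta>) \<phi>"
proof (cases "consistent T (\<phi> # \<Gamma>)")
  case True
  then show ?thesis by (intro exI[of _ "\<phi> # \<Gamma>"]) (auto simp: decides_def)
next
  case False
  have not: "\<not> derives T \<Gamma> \<phi>"
    using False con unfolding consistent_def by (blast intro: derives_cut)
  have neg: "derives T \<Gamma> (Neg \<phi>)"
    using False unfolding consistent_def Neg_def by (blast intro: derives.ImpI)
  have step: "consistent T (Neg \<chi> # Neg \<phi> # \<Gamma>)" if "\<not> derives T (Neg \<phi> # \<Gamma>) \<chi>" for \<chi>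
    using that unfolding consistent_def by (blast intro: derives.Contr)
  have con': "consistent T (Neg \<phi> # \<Gamma>)"
    using con neg unfolding consistent_def by (blast intro: derives_cut)
  obtain k where k: "\<forall>\<psi>\<in>set (Neg \<phi> # \<Gamma>). depends_below k \<psi>" "\<And>\<psi>. \<phi> = NAll \<psi> \<or> \<phi> = SAll \<psi> \<Longrightarrow> depends_below k \<psi>"
  proof -
    obtain k1 where k1: "\<forall>\<psi>\<in>set (Neg \<phi> # \<Gamma>). depends_below k1 \<psi>" using depends_below_list by blast
    \<comment> \<open>For formulas that are not universal the last branch is a dummy value.\<close>
    obtain k2 where "depends_below k2 (case \<phi> of NAll \<psi> \<Rightarrow> \<psi> | SAll \<psi> \<Rightarrow> \<psi> | _ \<Rightarrow> \<phi>)"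
      using depends_below_ex by blast
    then have k2: "depends_below k2 \<psi>" if "\<phi> = NAll \<psi> \<or> \<phi> = SAll \<psi>" for \<psi>
      using that by (elim disjE) simp_all
    show ?thesis
    proof (rule that[of "max k1 k2"])
      show "\<forall>\<psi>\<in>set (Neg \<phi> # \<Gamma>). depends_below (max k1 k2) \<psi>"
        using k1 depends_below_mono[OF _ max.cobounded1] by blast
      show "depends_below (max k1 k2) \<psi>" if "\<phi> = NAll \<psi> \<or> \<phi> = SAll \<psi>" for \<psi>
        by (rule depends_below_mono[OF k2[OF that] max.cobounded2])
    qed
  qed
  show ?thesis
  proof (cases \<phi>)
    case (NAll \<psi>)
    have "\<not> derives T (Neg \<phi> # \<Gamma>) (ninst (NVar k) \<psi>)"
    proof
      assume "derives T (Neg \<phi> # \<Gamma>) (ninst (NVar k) \<psi>)"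
      then have "derives T (Neg \<phi> # \<Gamma>) \<phi>" unfolding NAll
        by (rule NAll_fresh) (use k in \<open>auto simp: NAll\<close>)
      then show False using neg not by (blast intro: derives_cut)
    qed
    then have "consistent T (Neg (ninst (NVar k) \<psi>) # Neg \<phi> # \<Gamma>)" by (rule step)
    moreover have "decides (set (Neg (ninst (NVar k) \<psi>) # Neg \<phi> # \<Gamma>)) \<phi>"
      unfolding decides_def by (auto simp: NAll)
    ultimately show ?thesis by (metis set_subset_Cons order_trans)
  next
    case (SAll \<psi>)
    have "\<not> derives T (Neg \<phi> # \<Gamma>) (sinst k \<psi>)"
    proof
      assume "derives T (Neg \<phi> # \<Gamma>) (sinst k \<psi>)"
      then have "derives T (Neg \<phi> # \<Gamma>) \<phi>" unfolding SAll
        by (rule SAll_fresh) (use k in \<open>auto simp: SAll\<close>)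
      then show False using neg not by (blast intro: derives_cut)
    qed
    then have "consistent T (Neg (sinst k \<psi>) # Neg \<phi> # \<Gamma>)" by (rule step)
    moreover have "decides (set (Neg (sinst k \<psi>) # Neg \<phi> # \<Gamma>)) \<phi>"
      unfolding decides_def by (auto simp: SAll)
    ultimately show ?thesis by (metis set_subset_Cons order_trans)
  qed (use con' in \<open>auto intro!: exI[of _ "Neg \<phi> # \<Gamma>"] simp: decides_def\<close>)
qed

text \<open>Each formula is decided at its own stage of a countable enumeration. Consistency passes
  to the union because a finite list from the union already lies in one stage.\<close>

lemma henkin_extension:
  assumes "consistent T \<Gamma>"
  obtains H where "set \<Gamma> \<subseteq> H" "\<And>\<phi>. decides H \<phi>" "\<And>\<Delta>. set \<Delta> \<subseteq> H \<Longrightarrow> consistent T \<Delta>"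
proof -
  have "\<exists>G. \<forall>n. (consistent T (G n) \<and> set \<Gamma> \<subseteq> set (G n))
      \<and> (set (G n) \<subseteq> set (G (Suc n)) \<and> decides (set (G (Suc n))) (from_nat n))"
  proof (rule dependent_nat_choice)
    show "\<exists>\<Delta>. consistent T \<Delta> \<and> set \<Gamma> \<subseteq> set \<Delta>" using assms by blast
    show "\<exists>\<Delta>'. (consistent T \<Delta>' \<and> set \<Gamma> \<subseteq> set \<Delta>') \<and> set \<Delta> \<subseteq> set \<Delta>' \<and> decides (set \<Delta>') (from_nat n)"
      if "consistent T \<Delta> \<and> set \<Gamma> \<subseteq> set \<Delta>" for \<Delta> n
      using that consistent_decide[of T \<Delta> "from_nat n"] by (meson order_trans)
  qed
  then obtain G where G: "\<And>n. consistent T (G n)" "\<And>n. set \<Gamma> \<subseteq> set (G n)"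
    "\<And>n. set (G n) \<subseteq> set (G (Suc n))" "\<And>n. decides (set (G (Suc n))) (from_nat n)"
    by blast
  have mono: "set (G m) \<subseteq> set (G n)" if "m \<le> n" for m n
    using that G(3) by (rule lift_Suc_mono_le[of "\<lambda>n. set (G n)", rotated])
  let ?H = "\<Union>n. set (G n)"
  show ?thesis
  proof
    show "set \<Gamma> \<subseteq> ?H" using G(2) by blast
    show "decides ?H \<phi>" for \<phi>
      using G(4)[of "to_nat \<phi>"] by (auto intro: decides_mono)
    show "consistent T \<Delta>" if "set \<Delta> \<subseteq> ?H" for \<Delta>
    proof -
      have "\<exists>n. set \<Delta> \<subseteq> set (G n)" using that
      proof (induction \<Delta>)
        case (Cons \<phi> \<Delta>)
        then obtain m n where "\<phi> \<in> set (G m)" "set \<Delta> \<subseteq> set (G n)" by auto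
        then have "set (\<phi> # \<Delta>) \<subseteq> set (G (max m n))"
          using mono[of m "max m n"] mono[of n "max m n"] by auto
        then show ?case by blast
      qed simp
      then show ?thesis using G(1) unfolding consistent_def by (blast intro: derives_weaken)
    qed
  qed
qed

section \<open>The term model of a Henkin set\<close>

locale henkin =
  fixes T H :: "fm set"
  assumes decides: "decides H \<phi>"
    and consistent: "set \<Delta> \<subseteq> H \<Longrightarrow> consistent T \<Delta>"
    and succ_nonzero: "Neg (NEq (Plus (NVar 0) One) Zero) \<in> T"
    and succ_inject: "Imp (NEq (Plus (NVar 0) One) (Plus (NVar 1) One)) (NEq (NVar 0) (NVar 1)) \<in> T"
begin

lemma not_both: "\<phi> \<in> H \<Longrightarrow> Neg \<phi> \<notin> H"
proof
  assume "\<phi> \<in> H" "Neg \<phi> \<in> H"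
  then have "consistent T [\<phi>, Neg \<phi>]" by (intro consistent) auto
  moreover have "derives T [\<phi>, Neg \<phi>] Falsum"
    by (rule derives.ImpE[of _ _ \<phi>]) (auto simp: Neg_def intro: derives.Assm)
  ultimately show False by (simp add: consistent_def)
qed

lemma closed: "derives T \<Gamma> \<phi> \<Longrightarrow> set \<Gamma> \<subseteq> H \<Longrightarrow> \<phi> \<in> H"
proof (rule ccontr)
  assume d: "derives T \<Gamma> \<phi>" "set \<Gamma> \<subseteq> H" and "\<phi> \<notin> H"
  then have "Neg \<phi> \<in> H" using decides by (auto simp: decides_def)
  then have "consistent T (Neg \<phi> # \<Gamma>)" using d by (intro consistent) auto
  moreover have "derives T (Neg \<phi> # \<Gamma>) \<phi>" using d(1) by (rule derives_weaken) auto
  then have "derives T (Neg \<phi> # \<Gamma>) Falsum"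
    by (rule derives.ImpE[rotated]) (auto simp: Neg_def intro: derives.Assm)
  ultimately show False by (simp add: consistent_def)
qed

lemma instance_in: "\<phi> \<in> T \<Longrightarrow> fsub \<sigma> \<tau> \<phi> \<in> H"
  by (rule closed[of "[]"]) (auto intro: derives_subst_closed derives.Ax)

lemma Neg_in [simp]: "Neg \<phi> \<in> H \<longleftrightarrow> \<phi> \<notin> H"
  using not_both decides by (auto simp: decides_def)

lemma Falsum_notin [simp]: "Falsum \<notin> H"
proof
  assume "Falsum \<in> H"
  then have "consistent T [Falsum]" by (intro consistent) simp
  then show False unfolding consistent_def by (simp add: derives.Assm)
qed

lemma Imp_in [simp]: "Imp \<phi> \<psi> \<in> H \<longleftrightarrow> (\<phi> \<in> H \<longrightarrow> \<psi> \<in> H)"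
proof -
  have "\<psi> \<in> H" if "\<phi> \<in> H" "Imp \<phi> \<psi> \<in> H"
    by (rule closed[of "[\<phi>, Imp \<phi> \<psi>]"], rule derives.ImpE[of _ _ \<phi>])
       (use that in \<open>auto intro: derives.Assm\<close>)
  moreover have "Imp \<phi> \<psi> \<in> H" if "\<psi> \<in> H"
    by (rule closed[of "[\<psi>]"], rule derives.ImpI, rule derives.Assm) (use that in auto)
  moreover have "Imp \<phi> \<psi> \<in> H" if "\<phi> \<notin> H"
  proof (rule closed[of "[Neg \<phi>]"])
    have "derives T (Neg \<psi> # \<phi> # [Neg \<phi>]) Falsum"
      by (rule derives.ImpE[of _ _ \<phi>]) (auto simp: Neg_def intro: derives.Assm)
    then show "derives T [Neg \<phi>] (Imp \<phi> \<psi>)" using derives.ImpI derives.Contr by blast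
  qed (use that in simp)
  ultimately show ?thesis by blast
qed

lemma NAll_in [simp]: "NAll \<phi> \<in> H \<longleftrightarrow> (\<forall>t. ninst t \<phi> \<in> H)"
proof
  assume "NAll \<phi> \<in> H"
  then show "\<forall>t. ninst t \<phi> \<in> H"
    by (intro allI closed[of "[NAll \<phi>]"] derives.NAllE derives.Assm) auto
next
  assume *: "\<forall>t. ninst t \<phi> \<in> H"
  have "decides H (NAll \<phi>)" by (rule decides)
  with * show "NAll \<phi> \<in> H" by (auto simp: decides_def)
qed

lemma SAll_in [simp]: "SAll \<phi> \<in> H \<longleftrightarrow> (\<forall>X. sinst X \<phi> \<in> H)"
proof
  assume "SAll \<phi> \<in> H"
  then show "\<forall>X. sinst X \<phi> \<in> H"
    by (intro allI closed[of "[SAll \<phi>]"] derives.SAllE derives.Assm) auto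
next
  assume *: "\<forall>X. sinst X \<phi> \<in> H"
  have "decides H (SAll \<phi>)" by (rule decides)
  with * show "SAll \<phi> \<in> H" by (auto simp: decides_def)
qed

lemma NEq_refl [simp]: "NEq t t \<in> H"
  by (rule closed[of "[]"]) (auto intro: derives.NRefl)

lemma NEq_subst: "NEq s t \<in> H \<Longrightarrow> ninst s \<phi> \<in> H \<Longrightarrow> ninst t \<phi> \<in> H"
  by (rule closed[of "[NEq s t, ninst s \<phi>]"], rule derives.NSubst[of _ _ s]) (auto intro: derives.Assm)

lemma ninst_nlift [simp]: "tsub (case_nat s NVar) id (nlift t) = t"
  by (simp add: tsub_tsub)

lemma NEq_sym: "NEq s t \<in> H \<Longrightarrow> NEq t s \<in> H"
  using NEq_subst[of s t "NEq (NVar 0) (nlift s)"] by simp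

lemma NEq_trans: "NEq s t \<in> H \<Longrightarrow> NEq t u \<in> H \<Longrightarrow> NEq s u \<in> H"
  using NEq_subst[of t u "NEq (nlift s) (NVar 0)"] by simp

text \<open>Numbering the infinitely many classes of terms turns the whole type of natural numbers into
  the number sort.\<close>

definition cls0 :: "tm \<Rightarrow> tm set" where "cls0 t = {s. NEq t s \<in> H}"
definition cls :: "tm \<Rightarrow> nat" where "cls t = to_nat_on (range cls0) (cls0 t)"
definition rep :: "nat \<Rightarrow> tm" where "rep = inv cls"

lemma cls0_eq: "cls0 s = cls0 t \<longleftrightarrow> NEq s t \<in> H"
  unfolding cls0_def using NEq_sym NEq_trans NEq_refl by blast

text \<open>The successor acts injectively on the classes. On finitely many classes it would be
  surjective, and \<open>Zero\<close> would be a successor.\<close>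

lemma infinite_classes: "infinite (range cls0)"
proof
  assume fin: "finite (range cls0)"
  define S where "S = (\<lambda>c. cls0 (Plus (SOME t. cls0 t = c) One))"
  have S: "\<exists>t. cls0 t = c \<and> S c = cls0 (Plus t One)" if "c \<in> range cls0" for c
    using that unfolding S_def by (metis (mono_tags, lifting) rangeE someI)
  have "inj_on S (range cls0)"
  proof (rule inj_onI)
    fix c d assume cd: "c \<in> range cls0" "d \<in> range cls0" "S c = S d"
    then obtain s t where "cls0 s = c" "cls0 t = d" "NEq (Plus s One) (Plus t One) \<in> H"
      using S by (metis cls0_eq)
    moreover have "Imp (NEq (Plus s One) (Plus t One)) (NEq s t) \<in> H"
      using instance_in[OF succ_inject, of "case_nat s (\<lambda>_. t)" id] by simp
    ultimately show "c = d" using cls0_eq[of s t] by simp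
  qed
  moreover have "S ` range cls0 \<subseteq> range cls0" by (auto simp: S_def)
  ultimately have "S ` range cls0 = range cls0" using fin by (simp add: endo_inj_surj)
  then obtain t where "cls0 Zero = cls0 (Plus t One)" using S by (metis imageE rangeI)
  then have "NEq (Plus t One) Zero \<in> H" using cls0_eq NEq_sym by blast
  moreover have "Neg (NEq (Plus t One) Zero) \<in> H"
    using instance_in[OF succ_nonzero, of "\<lambda>_. t" id] by (simp add: Neg_def)
  ultimately show False by simp
qed

lemma cls_eq: "cls s = cls t \<longleftrightarrow> NEq s t \<in> H"
proof -
  have "countable (range cls0)" by simp
  from to_nat_on_inj[OF this] show ?thesis
    unfolding cls_def by (metis cls0_eq rangeI)
qed

lemma surj_cls: "surj cls"
proof -
  have "bij_betw (to_nat_on (range cls0)) (range cls0) UNIV"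
    by (rule to_nat_on_infinite) (use infinite_classes in auto)
  then have "to_nat_on (range cls0) ` range cls0 = UNIV" by (simp add: bij_betw_def)
  moreover have "range cls = to_nat_on (range cls0) ` range cls0"
    unfolding cls_def by auto
  ultimately show ?thesis by simp
qed

lemma cls_rep [simp]: "cls (rep a) = a"
  unfolding rep_def by (rule surj_f_inv_f[OF surj_cls])

lemma rep_cls: "NEq (rep (cls t)) t \<in> H"
  by (simp flip: cls_eq)

definition term_model :: "(nat, nat) struct" where
  "term_model = \<lparr> zero = cls Zero, one = cls One,
     add = (\<lambda>a b. cls (Plus (rep a) (rep b))), mul = (\<lambda>a b. cls (Times (rep a) (rep b))),
     len = (\<lambda>X. cls (Len X)), le = (\<lambda>a b. Leq (rep a) (rep b) \<in> H),
     mem = (\<lambda>a X. Mem (rep a) X \<in> H), seq = (\<lambda>X Y. SEq X Y \<in> H) \<rparr>"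

lemma Plus_cong: "NEq s s' \<in> H \<Longrightarrow> NEq t t' \<in> H \<Longrightarrow> NEq (Plus s t) (Plus s' t') \<in> H"
  using NEq_subst[of s s' "NEq (Plus (nlift s) (nlift t)) (Plus (NVar 0) (nlift t))"]
    NEq_subst[of t t' "NEq (Plus (nlift s) (nlift t)) (Plus (nlift s') (NVar 0))"] by simp

lemma Times_cong: "NEq s s' \<in> H \<Longrightarrow> NEq t t' \<in> H \<Longrightarrow> NEq (Times s t) (Times s' t') \<in> H"
  using NEq_subst[of s s' "NEq (Times (nlift s) (nlift t)) (Times (NVar 0) (nlift t))"]
    NEq_subst[of t t' "NEq (Times (nlift s) (nlift t)) (Times (nlift s') (NVar 0))"] by simp

lemma Leq_cong: "NEq s s' \<in> H \<Longrightarrow> NEq t t' \<in> H \<Longrightarrow> Leq s t \<in> H \<Longrightarrow> Leq s' t' \<in> H"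
  using NEq_subst[of s s' "Leq (NVar 0) (nlift t)"] NEq_subst[of t t' "Leq (nlift s') (NVar 0)"]
  by simp

lemma Mem_cong: "NEq s s' \<in> H \<Longrightarrow> Mem s X \<in> H \<Longrightarrow> Mem s' X \<in> H"
  using NEq_subst[of s s' "Mem (NVar 0) X"] by simp

lemma tmval_term_model: "tmval term_model (\<lambda>i. cls (\<sigma> i)) \<tau> t = cls (tsub \<sigma> \<tau> t)"
  by (induction t) (auto simp: term_model_def cls_eq intro: Plus_cong Times_cong rep_cls)

text \<open>The truth lemma. It speaks of all substitutions rather than of one fixed valuation
  because a quantifier extends the substitution by a term or a set variable; as every number is the
  class of a term, no value is missed.\<close>

lemma sat_term_model: "sat term_model (\<lambda>i. cls (\<sigma> i)) \<tau> \<phi> \<longleftrightarrow> fsub \<sigma> \<tau> \<phi> \<in> H"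
proof (induction \<phi> arbitrary: \<sigma> \<tau>)
  case (NEq s t)
  then show ?case by (simp add: tmval_term_model cls_eq)
next
  case (SEq X Y)
  then show ?case by (simp add: term_model_def)
next
  case (Leq s t)
  have "Leq (rep (cls s)) (rep (cls t)) \<in> H \<longleftrightarrow> Leq s t \<in> H" for s t
    using Leq_cong rep_cls NEq_sym by blast
  then show ?case by (simp add: tmval_term_model) (simp add: term_model_def)
next
  case (Mem t X)
  have "Mem (rep (cls t)) X \<in> H \<longleftrightarrow> Mem t X \<in> H" for t X
    using Mem_cong rep_cls NEq_sym by blast
  then show ?case by (simp add: tmval_term_model) (simp add: term_model_def)
next
  case (NAll \<phi>)
  have 1: "case_nat (cls t) (\<lambda>i. cls (\<sigma> i)) = (\<lambda>i. cls (case_nat t \<sigma> i))" for t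
    by (rule ext) (simp split: nat.split)
  have 2: "(\<lambda>i. tsub (case_nat t NVar) id (case_nat (NVar 0) (\<lambda>i. nlift (\<sigma> i)) i)) = case_nat t \<sigma>" for t
    by (rule ext) (simp split: nat.split)
  have "(\<forall>a. sat term_model (case_nat a (\<lambda>i. cls (\<sigma> i))) \<tau> \<phi>)
      \<longleftrightarrow> (\<forall>t. sat term_model (case_nat (cls t) (\<lambda>i. cls (\<sigma> i))) \<tau> \<phi>)"
    by (metis cls_rep)
  then show ?case by (simp add: fsub_fsub 1 2 NAll)
next
  case (SAll \<phi>)
  have 1: "(\<lambda>i. tsub NVar (case_nat X id) (slift (\<sigma> i))) = \<sigma>" for X
    by (rule ext) (simp add: tsub_tsub)
  have 2: "(\<lambda>i. case_nat X id (case_nat 0 (\<lambda>i. Suc (\<tau> i)) i)) = case_nat X \<tau>" for X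
    by (rule ext) (simp split: nat.split)
  show ?case by (simp add: fsub_fsub 1 2 SAll)
qed simp_all

lemma sat_term_model_axiom: "\<phi> \<in> T \<Longrightarrow> sat term_model v f \<phi>"
  using instance_in[of \<phi> "\<lambda>i. rep (v i)" f] sat_term_model[of "\<lambda>i. rep (v i)" f \<phi>] by simp

end

text \<open>The two successor axioms make the number sort of the term model infinite, hence a copy
  of all natural numbers. Validity therefore has to be checked only in structures over one fixed
  pair of types, and no quantification over types is needed.\<close>

theorem completeness:
  fixes T :: "fm set"
  assumes "Neg (NEq (Plus (NVar 0) One) Zero) \<in> T"
    and "Imp (NEq (Plus (NVar 0) One) (Plus (NVar 1) One)) (NEq (NVar 0) (NVar 1)) \<in> T"
    and valid: "\<And>(M :: (nat, nat) struct) v f.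
      (\<And>\<phi> v f. \<phi> \<in> T \<Longrightarrow> sat M v f \<phi>) \<Longrightarrow> sat M v f \<theta>"
  shows "T \<turnstile> \<theta>"
proof (rule ccontr)
  assume "\<not> T \<turnstile> \<theta>"
  then have "consistent T [Neg \<theta>]"
    unfolding proves_def consistent_def by (blast intro: derives.Contr)
  then show False
  proof (rule henkin_extension)
    fix H assume H: "set [Neg \<theta>] \<subseteq> H" "\<And>\<phi>. decides H \<phi>" "\<And>\<Delta>. set \<Delta> \<subseteq> H \<Longrightarrow> consistent T \<Delta>"
    interpret henkin T H
      using assms(1,2) H by (simp add: henkin_def)
    have "sat term_model (\<lambda>i. cls (NVar i)) id \<theta>"
      by (rule valid) (rule sat_term_model_axiom)
    then have "\<theta> \<in> H" by (simp only: sat_term_model fsub_NVar)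
    then show False using H(1) by simp
  qed
qed

section \<open>Definability and induction in models of V0(2)\<close>

lemma SigmaB0_fsub: "SigmaB0 \<phi> \<Longrightarrow> SigmaB0 (fsub \<sigma> \<tau> \<phi>)"
proof (induction arbitrary: \<sigma> \<tau> rule: SigmaB0.induct)
  case (7 \<phi> t)
  have "fsub \<sigma> \<tau> (BAll t \<phi>) = BAll (tsub \<sigma> \<tau> t) (fsub (case_nat (NVar 0) (\<lambda>i. nlift (\<sigma> i))) \<tau> \<phi>)"
    by (simp add: BAll_def tsub_tsub)
  then show ?case using 7 by (auto intro: SigmaB0.intros)
qed (auto intro: SigmaB0.intros)

locale V02_model =
  fixes M :: "('n, 's) struct"
  assumes axiom: "\<phi> \<in> V0_2 \<Longrightarrow> sat M v f \<phi>"
begin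

abbreviation plus (infixl "\<oplus>" 65) where "x \<oplus> y \<equiv> add M x y"
abbreviation times (infixl "\<otimes>" 70) where "x \<otimes> y \<equiv> mul M x y"
abbreviation leq (infix "\<preceq>" 50) where "x \<preceq> y \<equiv> le M x y"
abbreviation lt (infix "\<prec>" 50) where "x \<prec> y \<equiv> le M x y \<and> x \<noteq> y"
abbreviation Z ("\<zero>") where "\<zero> \<equiv> zero M"
abbreviation U ("\<one>") where "\<one> \<equiv> one M"

lemma basic: "\<phi> \<in> BASIC2 \<Longrightarrow> sat M v f \<phi>"
  by (rule axiom) (simp add: V0_2_def V0_def)

lemma succ_neq_zero [simp]: "x \<oplus> \<one> \<noteq> \<zero>"
  using basic[of "Neg (NEq (Plus (NVar 0) One) Zero)" "\<lambda>_. x"] by (simp add: BASIC2_def Let_def)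

lemma succ_eq [simp]: "x \<oplus> \<one> = y \<oplus> \<one> \<longleftrightarrow> x = y"
  using basic[of "Imp (NEq (Plus (NVar 0) One) (Plus (NVar 1) One)) (NEq (NVar 0) (NVar 1))"
      "case_nat x (\<lambda>_. y)"] by (auto simp add: BASIC2_def Let_def)

lemma add_zero [simp]: "x \<oplus> \<zero> = x"
  using basic[of "NEq (Plus (NVar 0) Zero) (NVar 0)" "\<lambda>_. x"] by (simp add: BASIC2_def Let_def)

lemma add_succ: "x \<oplus> (y \<oplus> \<one>) = (x \<oplus> y) \<oplus> \<one>"
  using basic[of "NEq (Plus (NVar 0) (Plus (NVar 1) One)) (Plus (Plus (NVar 0) (NVar 1)) One)"
      "case_nat x (\<lambda>_. y)"] by (simp add: BASIC2_def Let_def)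

lemma mul_zero [simp]: "x \<otimes> \<zero> = \<zero>"
  using basic[of "NEq (Times (NVar 0) Zero) Zero" "\<lambda>_. x"] by (simp add: BASIC2_def Let_def)

lemma mul_succ: "x \<otimes> (y \<oplus> \<one>) = x \<otimes> y \<oplus> x"
  using basic[of "NEq (Times (NVar 0) (Plus (NVar 1) One)) (Plus (Times (NVar 0) (NVar 1)) (NVar 0))"
      "case_nat x (\<lambda>_. y)"] by (simp add: BASIC2_def Let_def)

lemma le_antisym: "x \<preceq> y \<Longrightarrow> y \<preceq> x \<Longrightarrow> x = y"
  using basic[of "Imp (Leq (NVar 0) (NVar 1) \<^bold>\<and> Leq (NVar 1) (NVar 0)) (NEq (NVar 0) (NVar 1))"
      "case_nat x (\<lambda>_. y)"] by (simp add: BASIC2_def Let_def)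

lemma le_add [simp]: "x \<preceq> x \<oplus> y"
  using basic[of "Leq (NVar 0) (Plus (NVar 0) (NVar 1))" "case_nat x (\<lambda>_. y)"]
  by (simp add: BASIC2_def Let_def)

lemma zero_le [simp]: "\<zero> \<preceq> x"
  using basic[of "Leq Zero (NVar 0)" "\<lambda>_. x"] by (simp add: BASIC2_def Let_def)

lemma le_total: "x \<preceq> y \<or> y \<preceq> x"
  using basic[of "Leq (NVar 0) (NVar 1) \<^bold>\<or> Leq (NVar 1) (NVar 0)" "case_nat x (\<lambda>_. y)"]
  by (simp add: BASIC2_def Let_def)

lemma le_iff_lt_succ: "x \<preceq> y \<longleftrightarrow> x \<prec> y \<oplus> \<one>"
  using basic[of "Iff (Leq (NVar 0) (NVar 1)) (Less (NVar 0) (Plus (NVar 1) One))"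
      "case_nat x (\<lambda>_. y)"] by (simp add: BASIC2_def Let_def)

lemma zero_or_succ:
  obtains "x = \<zero>" | y where "x = y \<oplus> \<one>"
proof -
  have "x \<noteq> \<zero> \<longrightarrow> (\<exists>y. y \<oplus> \<one> = x)"
    using basic[of "Imp (Neg (NEq (NVar 0) Zero)) (BEx (NVar 0) (NEq (Plus (NVar 0) One) (nlift (NVar 0))))"
        "\<lambda>_. x"] by (auto simp add: BASIC2_def Let_def)
  then show ?thesis using that by blast
qed

lemma mem_lt_len: "mem M y X \<Longrightarrow> y \<prec> len M X"
  using basic[of "Imp (Mem (NVar 1) 0) (Less (NVar 1) (Len 0))" "\<lambda>_. y" "\<lambda>_. X"]
  by (simp add: BASIC2_def Let_def)

lemma mem_of_succ_eq_len: "y \<oplus> \<one> = len M X \<Longrightarrow> mem M y X"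
  using basic[of "Imp (NEq (Plus (NVar 1) One) (Len 0)) (Mem (NVar 1) 0)" "\<lambda>_. y" "\<lambda>_. X"]
  by (simp add: BASIC2_def Let_def)

lemma le_refl [simp]: "x \<preceq> x"
  using le_add[of x \<zero>] by simp

lemma lt_succ [simp]: "x \<noteq> x \<oplus> \<one>"
  using le_iff_lt_succ[of x x] by simp

lemma comprehension_sat:
  assumes "SigmaB0 \<phi>"
  obtains A where "len M A \<preceq> v 0" "\<And>a. a \<prec> v 0 \<Longrightarrow> mem M a A \<longleftrightarrow> sat M (case_nat a v) f \<phi>"
proof -
  have "sat M v f (comprehension \<phi>)"
    by (rule axiom) (use assms in \<open>auto simp: V0_2_def V0_def\<close>)
  then show ?thesis using that by (auto simp: comprehension_def)
qed

text \<open>A number is the length of some set, so set parameters can replace number parameters; the two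
  notions below then need no convention for separating variables from parameters.\<close>

lemma ex_len: "\<exists>X. len M X = c"
proof -
  \<comment> \<open>The singleton of the predecessor of \<open>c\<close>, which is empty for
    \<open>c = \<zero>\<close>. Its length is at most \<open>c\<close> by comprehension and exceeds
    its element, so it is \<open>c\<close>.\<close>
  obtain X where X: "len M X \<preceq> c" "\<And>a. a \<prec> c \<Longrightarrow> mem M a X \<longleftrightarrow> a \<oplus> \<one> = c"
    using comprehension_sat[of "NEq (Plus (NVar 0) One) (NVar 1)" "\<lambda>_. c"] SigmaB0.intros(2)
    by auto
  show ?thesis
  proof (cases rule: zero_or_succ[of c])
    case 1
    then show ?thesis using X(1) le_antisym by fastforce
  next
    case (2 m)
    then have m: "mem M m X" using X(2)[of m] le_iff_lt_succ[of m m] by simp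
    show ?thesis
    proof (cases rule: zero_or_succ[of "len M X"])
      case 1
      then show ?thesis using mem_lt_len[OF m] le_antisym zero_le by metis
    next
      case (2 k)
      show ?thesis
      proof (rule ccontr)
        assume no: "\<nexists>X. len M X = c"
        then have "k \<oplus> \<one> \<preceq> m"
          using X(1) 2 \<open>c = m \<oplus> \<one>\<close> le_iff_lt_succ[of "k \<oplus> \<one>" m] by metis
        moreover have "m \<preceq> k \<oplus> \<one>" "m \<noteq> k \<oplus> \<one>" using mem_lt_len[OF m] 2 by auto
        ultimately show False using le_antisym by blast
      qed
    qed
  qed
qed

section \<open>Definability by bounded formulas with parameters\<close>

definition tmdef :: "((nat \<Rightarrow> 'n) \<Rightarrow> 'n) \<Rightarrow> bool" where
  "tmdef T \<longleftrightarrow> (\<exists>t f. \<forall>v. T v = tmval M v f t)"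

definition fmdef :: "((nat \<Rightarrow> 'n) \<Rightarrow> bool) \<Rightarrow> bool" where
  "fmdef P \<longleftrightarrow> (\<exists>\<phi> f. SigmaB0 \<phi> \<and> (\<forall>v. P v \<longleftrightarrow> sat M v f \<phi>))"

text \<open>Both valuations are infinite sequences, so two formulas are brought under a common
  valuation by interleaving: one uses the even, the other the odd set variables.\<close>

definition merge :: "(nat \<Rightarrow> 's) \<Rightarrow> (nat \<Rightarrow> 's) \<Rightarrow> nat \<Rightarrow> 's" where
  "merge f g i = (if even i then f (i div 2) else g (i div 2))"

lemma merge_simps [simp]: "merge f g (2 * i) = f i" "merge f g (Suc (2 * i)) = g i"
  by (auto simp: merge_def)

lemma tmdef_tm2:
  assumes "tmdef S" "tmdef T"
  obtains s t f where "\<And>v. S v = tmval M v f s" "\<And>v. T v = tmval M v f t"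
proof -
  obtain s f t g where "\<And>v. S v = tmval M v f s" "\<And>v. T v = tmval M v g t"
    using assms unfolding tmdef_def by blast
  then show ?thesis
    by (intro that[where s="tsub NVar (\<lambda>i. 2 * i) s" and t="tsub NVar (\<lambda>i. Suc (2 * i)) t" and f="merge f g"])
       (simp_all add: tmval_tsub)
qed

lemma fmdef_fm2:
  assumes "fmdef P" "fmdef Q"
  obtains \<phi> \<psi> f where "SigmaB0 \<phi>" "SigmaB0 \<psi>" "\<And>v. P v \<longleftrightarrow> sat M v f \<phi>" "\<And>v. Q v \<longleftrightarrow> sat M v f \<psi>"
proof -
  obtain \<phi> f \<psi> g where "SigmaB0 \<phi>" "SigmaB0 \<psi>" "\<And>v. P v \<longleftrightarrow> sat M v f \<phi>" "\<And>v. Q v \<longleftrightarrow> sat M v g \<psi>"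
    using assms unfolding fmdef_def by blast
  then show ?thesis
    by (intro that[where \<phi>="fsub NVar (\<lambda>i. 2 * i) \<phi>" and \<psi>="fsub NVar (\<lambda>i. Suc (2 * i)) \<psi>" and f="merge f g"])
       (simp_all add: sat_fsub SigmaB0_fsub)
qed

lemma tmdef_var: "tmdef (\<lambda>v. v i)"
  unfolding tmdef_def by (intro exI[of _ "NVar i"]) simp

lemma tmdef_const: "tmdef (\<lambda>v. c)"
proof -
  obtain X where "len M X = c" using ex_len by blast
  then show ?thesis unfolding tmdef_def by (intro exI[of _ "Len 0"] exI[of _ "\<lambda>_. X"]) simp
qed

lemma tmdef_add: "tmdef S \<Longrightarrow> tmdef T \<Longrightarrow> tmdef (\<lambda>v. S v \<oplus> T v)"
  by (erule (1) tmdef_tm2) (unfold tmdef_def, metis tmval.simps(4))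

lemma tmdef_mul: "tmdef S \<Longrightarrow> tmdef T \<Longrightarrow> tmdef (\<lambda>v. S v \<otimes> T v)"
  by (erule (1) tmdef_tm2) (unfold tmdef_def, metis tmval.simps(5))

lemma fmdef_eq: "tmdef S \<Longrightarrow> tmdef T \<Longrightarrow> fmdef (\<lambda>v. S v = T v)"
  by (erule (1) tmdef_tm2) (unfold fmdef_def, metis sat.simps(2) SigmaB0.intros(2))

lemma fmdef_le: "tmdef S \<Longrightarrow> tmdef T \<Longrightarrow> fmdef (\<lambda>v. S v \<preceq> T v)"
  by (erule (1) tmdef_tm2) (unfold fmdef_def, metis sat.simps(4) SigmaB0.intros(4))

lemma fmdef_mem: assumes "tmdef T" shows "fmdef (\<lambda>v. mem M (T v) X)"
proof -
  obtain t f where t: "\<And>v. T v = tmval M v f t" using assms unfolding tmdef_def by blast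
  show ?thesis unfolding fmdef_def
    by (intro exI[of _ "Mem (tsub NVar Suc t) 0"] exI[of _ "case_nat X f"])
       (simp add: t tmval_tsub SigmaB0.intros)
qed

lemma fmdef_imp: "fmdef P \<Longrightarrow> fmdef Q \<Longrightarrow> fmdef (\<lambda>v. P v \<longrightarrow> Q v)"
  by (erule (1) fmdef_fm2) (unfold fmdef_def, metis sat.simps(6) SigmaB0.intros(6))

lemma fmdef_const: "fmdef (\<lambda>v. b)"
proof -
  have "\<exists>\<phi>. SigmaB0 \<phi> \<and> (\<forall>v f. b \<longleftrightarrow> sat M v f \<phi>)"
    by (cases b) (auto intro: exI[of _ "Falsum"] exI[of _ "Imp Falsum Falsum"] SigmaB0.intros)
  then show ?thesis unfolding fmdef_def by blast
qed

lemma fmdef_not: "fmdef P \<Longrightarrow> fmdef (\<lambda>v. \<not> P v)"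
  using fmdef_imp[of P "\<lambda>v. False"] fmdef_const[of False] by simp

lemma fmdef_con: "fmdef P \<Longrightarrow> fmdef Q \<Longrightarrow> fmdef (\<lambda>v. P v \<and> Q v)"
  using fmdef_not[OF fmdef_imp[of P "\<lambda>v. \<not> Q v"]] fmdef_not[of Q] by simp

lemma fmdef_dis: "fmdef P \<Longrightarrow> fmdef Q \<Longrightarrow> fmdef (\<lambda>v. P v \<or> Q v)"
  using fmdef_imp[of "\<lambda>v. \<not> P v" Q] fmdef_not[of P] by (simp add: disj_imp)

lemma fmdef_iff: "fmdef P \<Longrightarrow> fmdef Q \<Longrightarrow> fmdef (\<lambda>v. P v \<longleftrightarrow> Q v)"
  using fmdef_con[OF fmdef_imp[of P Q] fmdef_imp[of Q P]] by (simp add: iff_conv_conj_imp)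

text \<open>The premise on \<open>Q\<close> mirrors the de Bruijn convention: \<open>v 0\<close> is
  the bound variable and the tail of \<open>v\<close> is the outer valuation. The bound
  \<open>T\<close> is evaluated at the outer valuation, as \<open>BAll\<close> lifts its
  term.\<close>

lemma fmdef_ball:
  assumes "tmdef T" "fmdef (\<lambda>v. Q (v 0) (\<lambda>i. v (Suc i)))"
  shows "fmdef (\<lambda>v. \<forall>a. a \<preceq> T v \<longrightarrow> Q a v)"
proof -
  obtain t f where t: "\<And>v. T v = tmval M v f t" using assms(1) unfolding tmdef_def by blast
  obtain \<phi> g where \<phi>: "SigmaB0 \<phi>" "\<And>v. Q (v 0) (\<lambda>i. v (Suc i)) \<longleftrightarrow> sat M v g \<phi>"
    using assms(2) unfolding fmdef_def by blast
  have Q: "Q a v \<longleftrightarrow> sat M (case_nat a v) g \<phi>" for a v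
    using \<phi>(2)[of "case_nat a v"] by simp
  show ?thesis unfolding fmdef_def
    by (intro exI[of _ "BAll (tsub NVar (\<lambda>i. 2 * i) t) (fsub NVar (\<lambda>i. Suc (2 * i)) \<phi>)"]
        exI[of _ "merge f g"])
       (simp add: t Q tmval_tsub sat_fsub SigmaB0.intros SigmaB0_fsub \<phi>(1))
qed

lemma fmdef_bex:
  assumes "tmdef T" "fmdef (\<lambda>v. Q (v 0) (\<lambda>i. v (Suc i)))"
  shows "fmdef (\<lambda>v. \<exists>a. a \<preceq> T v \<and> Q a v)"
  using fmdef_not[OF fmdef_ball[OF assms(1) fmdef_not[OF assms(2)]]] by simp

text \<open>The rules follow the syntax of bounded formulas, so the side condition of an induction
  is settled by the shape of its predicate and no formula has to be written out.\<close>

lemmas def_intros = tmdef_var tmdef_const tmdef_add tmdef_mul fmdef_eq fmdef_le fmdef_mem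
  fmdef_con fmdef_dis fmdef_imp fmdef_iff fmdef_not fmdef_ball fmdef_bex fmdef_const

lemma definable_comprehension:
  assumes "fmdef (\<lambda>v. P (v 0))"
  shows "\<exists>A. len M A \<preceq> y \<and> (\<forall>a. a \<prec> y \<longrightarrow> (mem M a A \<longleftrightarrow> P a))"
proof -
  obtain \<phi> f where \<phi>: "SigmaB0 \<phi>" "\<And>v. P (v 0) \<longleftrightarrow> sat M v f \<phi>"
    using assms unfolding fmdef_def by blast
  have "P a \<longleftrightarrow> sat M (case_nat a v) f \<phi>" for a v
    using \<phi>(2)[of "case_nat a v"] by simp
  then show ?thesis
    using comprehension_sat[OF \<phi>(1), of "\<lambda>_. y" f] by metis
qed

lemma parity_vector:
  "\<exists>Y. \<not> mem M \<zero> Y \<and> (\<forall>z. z \<prec> b \<longrightarrow> (mem M (z \<oplus> \<one>) Y \<longleftrightarrow> (mem M z Y \<noteq> mem M z X)))"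
proof -
  have "sat M (\<lambda>_. b) (\<lambda>_. X) parity_axiom" by (rule axiom) (simp add: V0_2_def)
  then show ?thesis by (simp add: parity_axiom_def)
qed

text \<open>The set of all \<open>z \<le> c\<close> satisfying \<open>P\<close> cannot have a length below \<open>c + 1\<close>.\<close>

lemma induction [case_names definable zero succ]:
  assumes P: "fmdef (\<lambda>v. P (v 0))" and zero: "P \<zero>" and succ: "\<And>z. P z \<Longrightarrow> P (z \<oplus> \<one>)"
  shows "P c"
proof -
  obtain Y where Y: "len M Y \<preceq> c \<oplus> \<one>" "\<And>a. a \<prec> c \<oplus> \<one> \<Longrightarrow> mem M a Y \<longleftrightarrow> P a"
    using definable_comprehension[OF P, of "c \<oplus> \<one>"] by blast
  have mem: "mem M a Y \<longleftrightarrow> P a" if "a \<preceq> c" for a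
    using that Y(2) le_iff_lt_succ by blast
  show ?thesis
  proof (cases rule: zero_or_succ[of "len M Y"])
    case 1
    have "mem M \<zero> Y" using mem zero by simp
    from mem_lt_len[OF this] 1 show ?thesis by simp
  next
    case (2 m)
    then have m: "mem M m Y" using mem_of_succ_eq_len by simp
    have "m = c"
    proof (rule ccontr)
      assume "m \<noteq> c"
      then have mc: "m \<oplus> \<one> \<preceq> c" using Y(1) 2 le_iff_lt_succ[of "m \<oplus> \<one>" c] by simp
      moreover have "m \<preceq> c"
        using mc le_total[of m c] le_iff_lt_succ[of c m] le_antisym by metis
      ultimately have "mem M (m \<oplus> \<one>) Y" using mem m succ by blast
      from mem_lt_len[OF this] 2 show False by simp
    qed
    then show ?thesis using m mem by simp
  qed
qed

subsection \<open>Arithmetic\<close>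

lemma zero_add [simp]: "\<zero> \<oplus> x = x"
proof (induction x rule: induction)
  case definable
  show ?case by (intro def_intros)
next
  case (succ z)
  then show ?case by (simp add: add_succ)
qed simp

lemma succ_add: "(x \<oplus> \<one>) \<oplus> y = (x \<oplus> y) \<oplus> \<one>"
proof (induction y rule: induction)
  case definable
  show ?case by (intro def_intros)
next
  case (succ z)
  then show ?case by (simp add: add_succ)
qed simp

lemma add_comm: "x \<oplus> y = y \<oplus> x"
proof (induction y rule: induction)
  case definable
  show ?case by (intro def_intros)
next
  case (succ z)
  then show ?case by (simp add: add_succ succ_add)
qed simp

lemma add_assoc: "(x \<oplus> y) \<oplus> z = x \<oplus> (y \<oplus> z)"
proof (induction z rule: induction)
  case definable
  show ?case by (intro def_intros)
next
  case (succ z)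
  then show ?case by (simp add: add_succ)
qed simp

lemma add_left_comm: "x \<oplus> (y \<oplus> z) = y \<oplus> (x \<oplus> z)"
  by (metis add_assoc add_comm)

lemmas add_ac = add_assoc add_comm add_left_comm

lemma add_right_cancel [simp]: "x \<oplus> z = y \<oplus> z \<longleftrightarrow> x = y"
proof (induction z rule: induction)
  case definable
  show ?case by (intro def_intros)
next
  case (succ z)
  then show ?case by (simp add: add_succ)
qed simp

lemma add_left_cancel [simp]: "z \<oplus> x = z \<oplus> y \<longleftrightarrow> x = y"
  using add_right_cancel[of x z y] by (simp only: add_comm)

lemma zero_mul [simp]: "\<zero> \<otimes> x = \<zero>"
proof (induction x rule: induction)
  case definable
  show ?case by (intro def_intros)
next
  case (succ z)
  then show ?case by (simp add: mul_succ)
qed simp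

lemma succ_mul: "(x \<oplus> \<one>) \<otimes> y = x \<otimes> y \<oplus> y"
proof (induction y rule: induction)
  case definable
  show ?case by (intro def_intros)
next
  case (succ z)
  then show ?case by (simp add: mul_succ add_ac)
qed simp

lemma mul_comm: "x \<otimes> y = y \<otimes> x"
proof (induction y rule: induction)
  case definable
  show ?case by (intro def_intros)
next
  case (succ z)
  then show ?case by (simp add: mul_succ succ_mul)
qed simp

lemma mul_add: "x \<otimes> (y \<oplus> z) = x \<otimes> y \<oplus> x \<otimes> z"
proof (induction z rule: induction)
  case definable
  show ?case by (intro def_intros)
next
  case (succ z)
  then show ?case by (simp add: mul_succ flip: add_assoc)
qed simp

lemma add_mul: "(y \<oplus> z) \<otimes> x = y \<otimes> x \<oplus> z \<otimes> x"
  by (metis mul_add mul_comm)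

lemma one_mul [simp]: "\<one> \<otimes> x = x" "x \<otimes> \<one> = x"
  using mul_succ[of x \<zero>] by (simp_all add: mul_comm)

lemma le_iff_add: "x \<preceq> y \<longleftrightarrow> (\<exists>z. y = x \<oplus> z)"
proof
  \<comment> \<open>The witness \<open>z\<close> gets the bound \<open>y\<close> so that the
    statement is a bounded formula, as induction requires.\<close>
  have "\<forall>x. x \<preceq> y \<longrightarrow> (\<exists>z. z \<preceq> y \<and> y = x \<oplus> z)"
  proof (induction y rule: induction)
    case definable
    show ?case by (intro def_intros)
  next
    case zero
    then show ?case using le_antisym by force
  next
    case (succ y)
    show ?case
    proof (intro allI impI)
      fix x assume x: "x \<preceq> y \<oplus> \<one>"
      show "\<exists>z. z \<preceq> y \<oplus> \<one> \<and> y \<oplus> \<one> = x \<oplus> z"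
      proof (cases "x = y \<oplus> \<one>")
        case True
        then show ?thesis by (intro exI[of _ \<zero>]) simp
      next
        case False
        then obtain z where "y = x \<oplus> z" using succ x le_iff_lt_succ[of x y] by blast
        then show ?thesis
          by (intro exI[of _ "z \<oplus> \<one>"]) (metis add_succ add_comm le_add)
      qed
    qed
  qed
  then show "x \<preceq> y \<Longrightarrow> \<exists>z. y = x \<oplus> z" by blast
qed auto

lemma le_trans: "x \<preceq> y \<Longrightarrow> y \<preceq> z \<Longrightarrow> x \<preceq> z"
  by (metis le_iff_add add_assoc)

lemma not_le: "\<not> x \<preceq> y \<longleftrightarrow> y \<prec> x"
  using le_total le_antisym le_refl by blast

lemma lt_iff_succ_le: "x \<prec> y \<longleftrightarrow> x \<oplus> \<one> \<preceq> y"
  using not_le[of "x \<oplus> \<one>" y] not_le[of y x] le_iff_lt_succ[of y x] by metis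

lemma add_le_add_right [simp]: "x \<oplus> z \<preceq> y \<oplus> z \<longleftrightarrow> x \<preceq> y"
  unfolding le_iff_add by (metis add_assoc add_comm add_right_cancel)

lemma add_le_add_left [simp]: "z \<oplus> x \<preceq> z \<oplus> y \<longleftrightarrow> x \<preceq> y"
  using add_le_add_right[of x z y] by (simp only: add_comm)

lemma add_mono: "x \<preceq> y \<Longrightarrow> x' \<preceq> y' \<Longrightarrow> x \<oplus> x' \<preceq> y \<oplus> y'"
  by (meson add_le_add_left add_le_add_right le_trans)

lemma mul_mono: "x \<preceq> y \<Longrightarrow> x' \<preceq> y' \<Longrightarrow> x \<otimes> x' \<preceq> y \<otimes> y'"
  by (metis le_iff_add add_mul mul_add le_trans le_add)

subsection \<open>Pairing\<close>

text \<open>Twice the Cantor pairing function, so that no division by two occurs.\<close>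

definition pr :: "'n \<Rightarrow> 'n \<Rightarrow> 'n" where
  "pr x y = (x \<oplus> y) \<otimes> (x \<oplus> y \<oplus> \<one>) \<oplus> (\<one> \<oplus> \<one>) \<otimes> y"

lemma lt_le_trans: "x \<prec> y \<Longrightarrow> y \<preceq> z \<Longrightarrow> x \<prec> z"
  by (metis le_trans le_antisym)

lemma le_lt_trans: "x \<preceq> y \<Longrightarrow> y \<prec> z \<Longrightarrow> x \<prec> z"
  by (metis le_trans le_antisym)

lemma le_add2 [simp]: "x \<preceq> y \<oplus> x"
  using le_add[of x y] by (simp only: add_comm)

lemma lt_add_succ: "x \<prec> x \<oplus> y \<oplus> \<one>"
  using lt_iff_succ_le[of x "x \<oplus> y \<oplus> \<one>"] by simp

lemma two_mul: "(\<one> \<oplus> \<one>) \<otimes> x = x \<oplus> x"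
  by (simp add: add_mul)

lemma succ_product: "(s \<oplus> \<one>) \<otimes> (s \<oplus> \<one> \<oplus> \<one>) = s \<otimes> (s \<oplus> \<one>) \<oplus> (s \<oplus> s) \<oplus> \<one> \<oplus> \<one>"
proof -
  have "(s \<oplus> \<one>) \<otimes> (s \<oplus> \<one> \<oplus> \<one>) = (s \<otimes> (s \<oplus> \<one>) \<oplus> (s \<oplus> \<one>)) \<oplus> (s \<oplus> \<one>)"
    by (subst mul_succ) (subst succ_mul, rule refl)
  then show ?thesis by (simp only: add_ac)
qed

text \<open>The codes on the diagonal of sum \<open>s\<close> lie between \<open>s(s+1)\<close> and
  \<open>s(s+1) + 2s\<close>, and the next diagonal starts only at
  \<open>(s+1)(s+2)\<close>.\<close>

lemma pr_strict_mono:
  assumes "x \<oplus> y \<prec> x' \<oplus> y'"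
  shows "pr x y \<prec> pr x' y'"
proof -
  let ?s = "x \<oplus> y" and ?s' = "x' \<oplus> y'"
  let ?b = "?s \<otimes> (?s \<oplus> \<one>) \<oplus> (?s \<oplus> ?s)"
  have 1: "pr x y \<preceq> ?b"
    unfolding pr_def two_mul by (intro add_mono le_refl le_add2)
  have 2: "?b \<prec> (?s \<oplus> \<one>) \<otimes> (?s \<oplus> \<one> \<oplus> \<one>)"
    unfolding succ_product by (rule lt_add_succ)
  have 3: "(?s \<oplus> \<one>) \<otimes> (?s \<oplus> \<one> \<oplus> \<one>) \<preceq> ?s' \<otimes> (?s' \<oplus> \<one>)"
    using assms unfolding lt_iff_succ_le by (intro mul_mono) simp_all
  have 4: "?s' \<otimes> (?s' \<oplus> \<one>) \<preceq> pr x' y'" unfolding pr_def by (rule le_add)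
  show ?thesis
    by (rule lt_le_trans[OF le_lt_trans[OF 1 2] le_trans[OF 3 4]])
qed

lemma double_eq: "x \<oplus> x = y \<oplus> y \<longleftrightarrow> x = y"
proof -
  have "x \<oplus> x \<noteq> y \<oplus> y" if "x \<prec> y" for x y
    using that by (metis add_left_cancel add_le_add_left add_le_add_right le_antisym)
  then show ?thesis using not_le le_refl by metis
qed

lemma pr_eq [simp]: "pr x y = pr x' y' \<longleftrightarrow> x = x' \<and> y = y'"
proof
  assume eq: "pr x y = pr x' y'"
  then have s: "x \<oplus> y = x' \<oplus> y'"
    using pr_strict_mono[of x y x' y'] pr_strict_mono[of x' y' x y] not_le le_refl by metis
  then have "y \<oplus> y = y' \<oplus> y'" using eq by (simp add: pr_def two_mul)
  then show "x = x' \<and> y = y'" using s by (simp add: double_eq)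
qed simp

lemma le_pr [simp]: "x \<preceq> pr x y" "y \<preceq> pr x y"
proof -
  have "x \<oplus> y \<preceq> (x \<oplus> y) \<otimes> (x \<oplus> y \<oplus> \<one>)" by (simp only: mul_succ le_add2)
  then show "x \<preceq> pr x y" unfolding pr_def by (meson le_add le_trans)
  show "y \<preceq> pr x y" unfolding pr_def two_mul by (meson le_add2 le_trans)
qed

lemma tmdef_pr: "tmdef S \<Longrightarrow> tmdef T \<Longrightarrow> tmdef (\<lambda>v. pr (S v) (T v))"
  unfolding pr_def by (intro def_intros)

lemma tmdef_shift: "tmdef S \<Longrightarrow> tmdef (\<lambda>v. S (\<lambda>i. v (Suc i)))"
proof -
  assume "tmdef S"
  then obtain t f where "\<And>v. S v = tmval M v f t" unfolding tmdef_def by blast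
  then show ?thesis unfolding tmdef_def
    by (intro exI[of _ "tsub (\<lambda>i. NVar (Suc i)) id t"] exI[of _ f]) (simp add: tmval_tsub)
qed

section \<open>Parities along columns\<close>

text \<open>Admitting all definable arguments builds substitution of terms such as
  \<open>x \<oplus> \<one>\<close> into the notion.\<close>

definition fmdef2 :: "('n \<Rightarrow> 'n \<Rightarrow> bool) \<Rightarrow> bool" where
  "fmdef2 G \<longleftrightarrow> (\<forall>S T. tmdef S \<longrightarrow> tmdef T \<longrightarrow> fmdef (\<lambda>v. G (S v) (T v)))"

lemma fmdef2D: "fmdef2 G \<Longrightarrow> tmdef S \<Longrightarrow> tmdef T \<Longrightarrow> fmdef (\<lambda>v. G (S v) (T v))"
  unfolding fmdef2_def by blast

lemma flatten_lt: "x \<prec> x' \<Longrightarrow> y \<prec> N \<Longrightarrow> x \<otimes> N \<oplus> y \<prec> x' \<otimes> N \<oplus> y'"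
proof -
  assume x: "x \<prec> x'" and y: "y \<prec> N"
  have "x \<otimes> N \<oplus> y \<oplus> \<one> \<preceq> (x \<oplus> \<one>) \<otimes> N"
    using y lt_iff_succ_le[of y N] by (simp add: succ_mul add_assoc)
  moreover have "(x \<oplus> \<one>) \<otimes> N \<preceq> x' \<otimes> N"
    using x lt_iff_succ_le[of x x'] by (intro mul_mono) simp_all
  ultimately show ?thesis using lt_iff_succ_le by (meson le_add le_trans)
qed

lemma flatten_inj:
  assumes "x \<otimes> N \<oplus> y = x' \<otimes> N \<oplus> y'" "y \<prec> N" "y' \<prec> N"
  shows "x = x' \<and> y = y'"
proof -
  have "x = x'"
  proof (rule ccontr)
    assume "x \<noteq> x'"
    then have "x \<prec> x' \<or> x' \<prec> x" using not_le[of x x'] by blast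
    then show False
      using flatten_lt[of x x' y N y'] flatten_lt[of x' x y' N y] assms by auto
  qed
  then show ?thesis using assms(1) by simp
qed

lemma add_le_lt_mono: "x \<preceq> x' \<Longrightarrow> y \<prec> y' \<Longrightarrow> x \<oplus> y \<prec> x' \<oplus> y'"
  unfolding lt_iff_succ_le add_assoc by (rule add_mono)

text \<open>All columns are laid out in a single vector, so that one parity vector serves every column;
  the parity within a column is the difference of two of its entries.\<close>

lemma column_parity:
  assumes G: "fmdef2 G"
  shows "\<exists>Q. fmdef2 Q \<and> (\<forall>x. \<not> Q x \<zero>) \<and>
    (\<forall>x y. x \<preceq> N \<longrightarrow> y \<prec> N \<longrightarrow> (Q x (y \<oplus> \<one>) \<longleftrightarrow> (Q x y \<noteq> G x y)))"
proof -
  let ?P = "\<lambda>k. \<exists>x. x \<preceq> N \<and> (\<exists>y. y \<preceq> N \<and> y \<noteq> N \<and> k = x \<otimes> N \<oplus> y \<and> G x y)"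
  have "fmdef (\<lambda>v. ?P (v 0))"
    by (intro def_intros fmdef2D[OF G])
  \<comment> \<open>The columns 0 to \<open>N\<close> have \<open>N\<close> entries each, which
    makes \<open>N \<otimes> N \<oplus> N\<close> positions.\<close>
  from definable_comprehension[where P="?P", OF this, of "N \<otimes> N \<oplus> N"]
  obtain X where X: "\<And>k. k \<prec> N \<otimes> N \<oplus> N \<Longrightarrow>
      mem M k X \<longleftrightarrow> (\<exists>x. x \<preceq> N \<and> (\<exists>y. y \<preceq> N \<and> y \<noteq> N \<and> k = x \<otimes> N \<oplus> y \<and> G x y))"
    by blast
  obtain Y where Y: "\<And>z. z \<prec> N \<otimes> N \<oplus> N \<Longrightarrow> mem M (z \<oplus> \<one>) Y \<longleftrightarrow> (mem M z Y \<noteq> mem M z X)"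
    using parity_vector[of "N \<otimes> N \<oplus> N" X] by blast
  \<comment> \<open>The total \<open>Q x N\<close> of a column is read at the position where column
    \<open>x + 1\<close> begins, so no separators between columns are needed.\<close>
  define Q where "Q x y \<longleftrightarrow> (mem M (x \<otimes> N \<oplus> y) Y \<longleftrightarrow> \<not> mem M (x \<otimes> N) Y)" for x y
  show ?thesis
  proof (intro exI conjI allI impI)
    show "fmdef2 Q" unfolding fmdef2_def Q_def by (intro allI impI def_intros)
    show "\<not> Q x \<zero>" for x by (simp add: Q_def)
    show "Q x (y \<oplus> \<one>) \<longleftrightarrow> (Q x y \<noteq> G x y)" if "x \<preceq> N" "y \<prec> N" for x y
    proof -
      have "x \<otimes> N \<preceq> N \<otimes> N" using that by (intro mul_mono) auto
      then have lt: "x \<otimes> N \<oplus> y \<prec> N \<otimes> N \<oplus> N"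
        using that(2) by (rule add_le_lt_mono)
      have "mem M (x \<otimes> N \<oplus> y) X \<longleftrightarrow> G x y"
      proof -
        have "?P (x \<otimes> N \<oplus> y) \<longleftrightarrow> G x y"
        proof
          assume "?P (x \<otimes> N \<oplus> y)"
          then obtain x' y' where *: "y' \<prec> N" "x \<otimes> N \<oplus> y = x' \<otimes> N \<oplus> y'" "G x' y'" by blast
          then show "G x y" using flatten_inj[OF *(2) that(2) *(1)] by simp
        qed (use that in blast)
        then show ?thesis using X[OF lt] by simp
      qed
      then show ?thesis using Y[OF lt] unfolding Q_def add_succ by blast
    qed
  qed
qed

lemma column_parity_empty:
  assumes Q: "fmdef2 Q" "\<And>x. \<not> Q x \<zero>" "\<And>x y. x \<preceq> N \<Longrightarrow> y \<prec> N \<Longrightarrow> Q x (y \<oplus> \<one>) \<longleftrightarrow> (Q x y \<noteq> G x y)"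
    and x: "x \<preceq> N" "\<And>y. \<not> G x y"
  shows "y \<preceq> N \<longrightarrow> \<not> Q x y"
proof (induction y rule: induction)
  case definable
  show ?case by (intro def_intros fmdef2D[OF Q(1)])
next
  case zero
  show ?case using Q(2) by simp
next
  case (succ y)
  show ?case using succ Q(3)[OF x(1), of y] x(2) lt_iff_succ_le by blast
qed

text \<open>\<open>H x y\<close> and \<open>V x y\<close> stand for the edges that arrive at \<open>(x, y)\<close> from the left and from below.
  Adding up the degrees in column \<open>x\<close> below height \<open>y\<close> counts every vertical edge twice except the one
  that leads to height \<open>y\<close>.\<close>

lemma column_sum:
  assumes Q: "fmdef2 Q" "\<And>x. \<not> Q x \<zero>" "\<And>x y. x \<preceq> N \<Longrightarrow> y \<prec> N \<Longrightarrow> Q x (y \<oplus> \<one>) \<longleftrightarrow> (Q x y \<noteq> H x y)"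
    and V: "fmdef2 V" "\<not> V x \<zero>"
    and od: "\<And>T. tmdef T \<Longrightarrow> fmdef (\<lambda>v. od (T v))" "\<not> od \<zero>"
      "\<And>y. y \<prec> N \<Longrightarrow> od (y \<oplus> \<one>) \<longleftrightarrow> (od y \<noteq> (H x y \<noteq> (H (x \<oplus> \<one>) y \<noteq> (V x y \<noteq> V x (y \<oplus> \<one>)))))"
    and x: "x \<prec> N"
  shows "y \<preceq> N \<longrightarrow> ((Q x y \<noteq> Q (x \<oplus> \<one>) y) \<longleftrightarrow> (V x y \<noteq> od y))"
proof (induction y rule: induction)
  case definable
  show ?case by (intro def_intros fmdef2D[OF Q(1)] fmdef2D[OF V(1)] od(1))
next
  case zero
  show ?case using Q(2) V(2) od(2) by simp
next
  case (succ y)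
  show ?case
  proof
    assume "y \<oplus> \<one> \<preceq> N"
    then have y: "y \<prec> N" by (simp add: lt_iff_succ_le)
    have x1: "x \<oplus> \<one> \<preceq> N" using x by (simp add: lt_iff_succ_le)
    show "(Q x (y \<oplus> \<one>) \<noteq> Q (x \<oplus> \<one>) (y \<oplus> \<one>)) \<longleftrightarrow> (V x (y \<oplus> \<one>) \<noteq> od (y \<oplus> \<one>))"
      \<comment> \<open>\<open>od y\<close> is the parity of the number of odd vertices of the
        column below \<open>y\<close>. In the xor of the induction hypothesis with the three
        recursions \<open>H x y\<close>, \<open>H (x + 1) y\<close> and \<open>V x y\<close>
        cancel.\<close>
      using succ y od(3)[OF y] Q(3)[OF x1 y] Q(3)[of x y] x by blast
  qed
qed

section \<open>Edge sets in a model\<close>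

text \<open>The left or lower end comes first: its coordinate sum and hence its code under
  \<open>pr\<close> is the smaller one, and \<open>is_edge\<close> lists the ends of an edge by
  increasing code.\<close>

definition hcode :: "'n \<Rightarrow> 'n \<Rightarrow> 'n" where "hcode x y = pr (pr x y) (pr (x \<oplus> \<one>) y)"
definition vcode :: "'n \<Rightarrow> 'n \<Rightarrow> 'n" where "vcode x y = pr (pr x y) (pr x (y \<oplus> \<one>))"

definition edges :: "'n \<Rightarrow> 's \<Rightarrow> bool" where
  "edges n E \<longleftrightarrow> (\<forall>e. mem M e E \<longrightarrow>
     (\<exists>x y. x \<prec> n \<and> y \<preceq> n \<and> e = hcode x y) \<or> (\<exists>x y. x \<preceq> n \<and> y \<prec> n \<and> e = vcode x y))"

definition inc :: "'s \<Rightarrow> 'n \<Rightarrow> 'n \<Rightarrow> bool" where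
  "inc E e p \<longleftrightarrow> mem M e E \<and> (\<exists>q. e = pr p q \<or> e = pr q p)"

text \<open>Indexing an edge by its right end avoids subtraction: nothing arrives in column 0, and
  the edges leaving column \<open>n\<close> to the right would be those of column
  \<open>n + 1\<close>.\<close>

definition hedge :: "'s \<Rightarrow> 'n \<Rightarrow> 'n \<Rightarrow> bool" where
  "hedge E x y \<longleftrightarrow> (\<exists>u. x = u \<oplus> \<one> \<and> mem M (hcode u y) E)"

definition vedge :: "'s \<Rightarrow> 'n \<Rightarrow> 'n \<Rightarrow> bool" where
  "vedge E x y \<longleftrightarrow> (\<exists>u. y = u \<oplus> \<one> \<and> mem M (vcode x u) E)"

definition touches :: "'s \<Rightarrow> 'n \<Rightarrow> 'n \<Rightarrow> bool" where
  "touches E x y \<longleftrightarrow> hedge E x y \<or> hedge E (x \<oplus> \<one>) y \<or> vedge E x y \<or> vedge E x (y \<oplus> \<one>)"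

definition odd_degree :: "'s \<Rightarrow> 'n \<Rightarrow> 'n \<Rightarrow> bool" where
  "odd_degree E x y \<longleftrightarrow>
     (hedge E x y \<noteq> (hedge E (x \<oplus> \<one>) y \<noteq> (vedge E x y \<noteq> vedge E x (y \<oplus> \<one>))))"

lemma fmdef2_hedge: "fmdef2 (hedge E)"
proof -
  have "hedge E x y \<longleftrightarrow> (\<exists>u. u \<preceq> x \<and> (x = u \<oplus> \<one> \<and> mem M (hcode u y) E))" for x y
    unfolding hedge_def by auto
  then show ?thesis unfolding fmdef2_def hcode_def
    by (simp only:) (intro allI impI def_intros tmdef_pr tmdef_shift; assumption)
qed

lemma fmdef2_vedge: "fmdef2 (vedge E)"
proof -
  have "vedge E x y \<longleftrightarrow> (\<exists>u. u \<preceq> y \<and> (y = u \<oplus> \<one> \<and> mem M (vcode x u) E))" for x y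
    unfolding vedge_def by auto
  then show ?thesis unfolding fmdef2_def vcode_def
    by (simp only:) (intro allI impI def_intros tmdef_pr tmdef_shift; assumption)
qed

lemma hedge_zero [simp]: "\<not> hedge E \<zero> y"
  unfolding hedge_def using succ_neq_zero by metis

lemma vedge_zero [simp]: "\<not> vedge E x \<zero>"
  unfolding vedge_def using succ_neq_zero by metis

lemma hedge_succ: "hedge E (x \<oplus> \<one>) y \<longleftrightarrow> mem M (hcode x y) E"
  unfolding hedge_def by auto

lemma vedge_succ: "vedge E x (y \<oplus> \<one>) \<longleftrightarrow> mem M (vcode x y) E"
  unfolding vedge_def by auto

lemma hcode_vcode_eq [simp]:
  "hcode x y = hcode x' y' \<longleftrightarrow> x = x' \<and> y = y'" "vcode x y = vcode x' y' \<longleftrightarrow> x = x' \<and> y = y'"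
  "hcode x y \<noteq> vcode x' y'" "vcode x' y' \<noteq> hcode x y"
  unfolding hcode_def vcode_def by (auto simp: lt_succ[symmetric])

lemma edgesD:
  assumes "edges n E"
  shows "mem M (hcode x y) E \<Longrightarrow> x \<prec> n \<and> y \<preceq> n" "mem M (vcode x y) E \<Longrightarrow> x \<preceq> n \<and> y \<prec> n"
  using assms unfolding edges_def by fastforce+

lemma hedge_boundary: "edges n E \<Longrightarrow> \<not> hedge E (n \<oplus> \<one>) y"
  using edgesD(1)[of n E n y] by (auto simp: hedge_succ)

lemma vedge_boundary: "edges n E \<Longrightarrow> \<not> vedge E x (n \<oplus> \<one>)"
  using edgesD(2)[of n E x n] by (auto simp: vedge_succ)

section \<open>Degrees of a point and their parities\<close>

lemma inc_iff:
  assumes E: "edges n E"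
  shows "inc E e (pr x y) \<longleftrightarrow>
     (\<exists>u. x = u \<oplus> \<one> \<and> e = hcode u y \<and> mem M e E) \<or> (e = hcode x y \<and> mem M e E) \<or>
     (\<exists>u. y = u \<oplus> \<one> \<and> e = vcode x u \<and> mem M e E) \<or> (e = vcode x y \<and> mem M e E)"
    (is "?l \<longleftrightarrow> ?r")
proof
  assume "?l"
  then have m: "mem M e E" and p: "\<exists>q. e = pr (pr x y) q \<or> e = pr q (pr x y)" by (auto simp: inc_def)
  then consider (h) x' y' where "e = hcode x' y'" | (v) x' y' where "e = vcode x' y'"
    using E unfolding edges_def by blast
  then show ?r
  proof cases
    case h
    then show ?thesis using m p by (auto simp: hcode_def)
  next
    case v
    then show ?thesis using m p by (auto simp: vcode_def)
  qed
next
  assume ?r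
  then show ?l unfolding inc_def hcode_def vcode_def by blast
qed

text \<open>With the four possible edges at a point named and told apart, passing from a degree to
  its parity is a matter of propositional logic with equality.\<close>

lemma inc_cases:
  assumes E: "edges n E"
  shows "\<exists>e1 e2 e3 e4. (hedge E x y \<longrightarrow> e1 \<noteq> e2) \<and> e1 \<noteq> e3 \<and> e1 \<noteq> e4 \<and> e2 \<noteq> e3 \<and> e2 \<noteq> e4
    \<and> (vedge E x y \<longrightarrow> e3 \<noteq> e4)
    \<and> (\<forall>e. inc E e (pr x y) \<longleftrightarrow> hedge E x y \<and> e = e1 \<or> hedge E (x \<oplus> \<one>) y \<and> e = e2 \<or>
       vedge E x y \<and> e = e3 \<or> vedge E x (y \<oplus> \<one>) \<and> e = e4)"
proof -
  \<comment> \<open>In column 0 there is no predecessor and \<open>xp\<close> is arbitrary, likewise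
    \<open>yp\<close> in row 0. This is why \<open>e1 \<noteq> e2\<close> and
    \<open>e3 \<noteq> e4\<close> are claimed only when the edge from the left or from below
    exists.\<close>
  define xp yp where "xp = (SOME u. x = u \<oplus> \<one>)" and "yp = (SOME u. y = u \<oplus> \<one>)"
  have xp: "xp = u" if "x = u \<oplus> \<one>" for u using that unfolding xp_def by simp
  have yp: "yp = u" if "y = u \<oplus> \<one>" for u using that unfolding yp_def by simp
  show ?thesis
  proof (intro exI conjI impI allI)
    show "hcode xp y \<noteq> hcode x y" if "hedge E x y"
    proof -
      obtain u where u: "x = u \<oplus> \<one>" using \<open>hedge E x y\<close> unfolding hedge_def by blast
      show ?thesis using xp[OF u] u by simp
    qed
    show "vcode x yp \<noteq> vcode x y" if "vedge E x y"
    proof -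
      obtain u where u: "y = u \<oplus> \<one>" using \<open>vedge E x y\<close> unfolding vedge_def by blast
      show ?thesis using yp[OF u] u by simp
    qed
    show "inc E e (pr x y) \<longleftrightarrow> hedge E x y \<and> e = hcode xp y \<or> hedge E (x \<oplus> \<one>) y \<and> e = hcode x y \<or>
       vedge E x y \<and> e = vcode x yp \<or> vedge E x (y \<oplus> \<one>) \<and> e = vcode x y" for e
    proof -
      have "(\<exists>u. x = u \<oplus> \<one> \<and> e = hcode u y \<and> mem M e E) \<longleftrightarrow> hedge E x y \<and> e = hcode xp y"
        unfolding hedge_def using xp by auto
      moreover have "(\<exists>u. y = u \<oplus> \<one> \<and> e = vcode x u \<and> mem M e E) \<longleftrightarrow> vedge E x y \<and> e = vcode x yp"
        unfolding vedge_def using yp by auto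
      ultimately show ?thesis unfolding inc_iff[OF E] hedge_succ vedge_succ by auto
    qed
  qed simp_all
qed

lemma touches_iff: "edges n E \<Longrightarrow> touches E x y \<longleftrightarrow> (\<exists>e. inc E e (pr x y))"
  unfolding touches_def using inc_cases[of n E x y] by blast

lemma odd_degree_of_deg1:
  assumes E: "edges n E" and "inc E e (pr x y)" "\<And>e'. inc E e' (pr x y) \<Longrightarrow> e' = e"
  shows "odd_degree E x y"
proof -
  obtain e1 e2 e3 e4 where *: "hedge E x y \<longrightarrow> e1 \<noteq> e2" "e1 \<noteq> e3" "e1 \<noteq> e4" "e2 \<noteq> e3" "e2 \<noteq> e4"
    "vedge E x y \<longrightarrow> e3 \<noteq> e4"
    "\<And>e. inc E e (pr x y) \<longleftrightarrow> hedge E x y \<and> e = e1 \<or> hedge E (x \<oplus> \<one>) y \<and> e = e2 \<or>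
       vedge E x y \<and> e = e3 \<or> vedge E x (y \<oplus> \<one>) \<and> e = e4"
    using inc_cases[OF E, of x y] by blast
  show ?thesis
    using assms(2) assms(3)[of e1] assms(3)[of e2] assms(3)[of e3] assms(3)[of e4] *(1-6)
    unfolding odd_degree_def *(7) by argo
qed

lemma even_degree_of_deg2:
  assumes E: "edges n E" and "inc E e (pr x y)" "inc E e' (pr x y)" "e \<noteq> e'"
    "\<And>e''. inc E e'' (pr x y) \<Longrightarrow> e'' = e \<or> e'' = e'"
  shows "\<not> odd_degree E x y"
proof -
  obtain e1 e2 e3 e4 where *: "hedge E x y \<longrightarrow> e1 \<noteq> e2" "e1 \<noteq> e3" "e1 \<noteq> e4" "e2 \<noteq> e3" "e2 \<noteq> e4"
    "vedge E x y \<longrightarrow> e3 \<noteq> e4"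
    "\<And>e. inc E e (pr x y) \<longleftrightarrow> hedge E x y \<and> e = e1 \<or> hedge E (x \<oplus> \<one>) y \<and> e = e2 \<or>
       vedge E x y \<and> e = e3 \<or> vedge E x (y \<oplus> \<one>) \<and> e = e4"
    using inc_cases[OF E, of x y] by blast
  show ?thesis
    using assms(2-4) assms(5)[of e1] assms(5)[of e2] assms(5)[of e3] assms(5)[of e4] *(1-6)
    unfolding odd_degree_def *(7) by argo
qed

section \<open>The separation argument\<close>

lemma separation:
  assumes B: "edges n B" and R: "edges n R"
    and even: "\<And>x y. x \<preceq> n \<Longrightarrow> y \<preceq> n \<Longrightarrow> \<not> odd_degree B x y"
    and odd: "\<And>x y. x \<preceq> n \<Longrightarrow> y \<preceq> n \<Longrightarrow> odd_degree R x y \<longleftrightarrow> x = a \<and> (y = b \<or> y = b \<oplus> \<one> \<oplus> \<one>)"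
    and disjoint: "\<And>x y. x \<preceq> n \<Longrightarrow> y \<preceq> n \<Longrightarrow> \<not> (touches B x y \<and> touches R x y)"
    and a: "a \<preceq> n" and b: "b \<oplus> \<one> \<oplus> \<one> \<preceq> n"
    and lower: "\<not> touches B a b" and upper: "\<not> touches B a (b \<oplus> \<one> \<oplus> \<one>)"
    and middle: "touches B a (b \<oplus> \<one>)"
  shows False
proof -
  \<comment> \<open>One more than the last coordinate: the rows \<open>y \<prec> ?N\<close> are
    those of the grid, while the columns \<open>x \<preceq> ?N\<close> include the empty one beyond
    it.\<close>
  let ?N = "n \<oplus> \<one>"
  have less: "x \<prec> ?N" if "x \<preceq> n" for x by (rule le_iff_lt_succ[THEN iffD1, OF that])
  have b1: "b \<oplus> \<one> \<preceq> n" by (rule le_trans[OF le_add b])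
  have b0: "b \<preceq> n" by (rule le_trans[OF le_add b1])

  have no_lt_zero: "\<not> x \<prec> \<zero>" for x using le_antisym[OF _ zero_le, of x] by blast
  have lt_succ_cases: "x \<prec> y \<oplus> \<one> \<longleftrightarrow> x \<prec> y \<or> x = y" for x y
    unfolding le_iff_lt_succ[symmetric] by auto
  obtain w where "fmdef2 w \<and> (\<forall>x. \<not> w x \<zero>) \<and>
    (\<forall>x y. x \<preceq> ?N \<longrightarrow> y \<prec> ?N \<longrightarrow> (w x (y \<oplus> \<one>) \<longleftrightarrow> (w x y \<noteq> hedge B x y)))"
    using column_parity[OF fmdef2_hedge, of ?N B] by (rule exE)
  then have w: "fmdef2 w" "\<And>x. \<not> w x \<zero>"
    "\<And>x y. x \<preceq> ?N \<Longrightarrow> y \<prec> ?N \<Longrightarrow> w x (y \<oplus> \<one>) \<longleftrightarrow> (w x y \<noteq> hedge B x y)"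
    by simp_all
  have w_right: "w (x \<oplus> \<one>) y \<longleftrightarrow> w x y" if xy: "x \<preceq> n" "y \<preceq> n" and t: "\<not> touches B x y" for x y
  proof -
    have "y \<preceq> ?N \<longrightarrow> ((w x y \<noteq> w (x \<oplus> \<one>) y) \<longleftrightarrow> (vedge B x y \<noteq> False))"
    \<comment> \<open>All degrees of \<open>B\<close> are even, so \<open>od\<close> is constantly
      \<open>False\<close>. The two parities can then differ only by the vertical edge arriving at
      \<open>(x, y)\<close>, and a point not on \<open>B\<close> has none.\<close>
    proof (rule column_sum[OF w fmdef2_vedge vedge_zero])
      show "False \<longleftrightarrow> (False \<noteq> (hedge B x z \<noteq> (hedge B (x \<oplus> \<one>) z \<noteq> (vedge B x z \<noteq> vedge B x (z \<oplus> \<one>)))))"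
        if "z \<prec> ?N" for z
        using even[OF xy(1) le_iff_lt_succ[THEN iffD2, OF that]] unfolding odd_degree_def by simp
    qed (use xy(1) less fmdef_const in auto)
    then show ?thesis using t less[OF xy(2)] by (simp add: touches_def)
  qed
  have w_up: "w x (y \<oplus> \<one>) \<longleftrightarrow> w x y" if "x \<preceq> n" "y \<preceq> n" "\<not> touches B x y" for x y
    using w(3)[of x y] less that by (simp add: touches_def)

  \<comment> \<open>The midpoint has no vertical edges, since these would touch one of the two
    points. Being on \<open>B\<close> with even degree, it has both horizontal edges, and the left
    one is the crossing that changes \<open>w\<close>.\<close>
  have "\<not> vedge B a (b \<oplus> \<one>)" using lower by (simp add: touches_def)
  moreover have "\<not> vedge B a (b \<oplus> \<one> \<oplus> \<one>)" using upper by (simp add: touches_def)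
  ultimately have "hedge B a (b \<oplus> \<one>)"
    using middle even[OF a b1] unfolding touches_def odd_degree_def by blast
  then have sides: "w a (b \<oplus> \<one> \<oplus> \<one>) \<longleftrightarrow> \<not> w a b"
    using w(3)[of a "b \<oplus> \<one>"] less[OF a] less[OF b1] w_up[OF a b0 lower] by simp
  \<comment> \<open>The height of the one end of \<open>R\<close> at which \<open>w\<close>
    holds.\<close>
  define q where "q = (if w a b then b else b \<oplus> \<one> \<oplus> \<one>)"
  have q: "y = b \<or> y = b \<oplus> \<one> \<oplus> \<one> \<Longrightarrow> w a y \<longleftrightarrow> y = q" "q = b \<or> q = b \<oplus> \<one> \<oplus> \<one>" for y
    using sides unfolding q_def by auto
  have qn: "q \<preceq> n" unfolding q_def using b b0 by simp

  text \<open>The edges of \<open>R\<close> on the side of \<open>B\<close> where \<open>w\<close> holds have exactly one vertex of odd degree.\<close>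

  define H where "H x y \<longleftrightarrow> hedge R x y \<and> w x y" for x y
  define V where "V x y \<longleftrightarrow> vedge R x y \<and> w x y" for x y
  have defs: "fmdef2 H" "fmdef2 V"
    using fmdef2_hedge[of R] fmdef2_vedge[of R] w(1) unfolding fmdef2_def H_def V_def
    by (auto intro: fmdef_con)
  have sum: "(H x y \<noteq> (H (x \<oplus> \<one>) y \<noteq> (V x y \<noteq> V x (y \<oplus> \<one>)))) \<longleftrightarrow> x = a \<and> y = q"
    if xy: "x \<preceq> n" "y \<preceq> n" for x y
  proof -
    have "(H x y \<noteq> (H (x \<oplus> \<one>) y \<noteq> (V x y \<noteq> V x (y \<oplus> \<one>)))) \<longleftrightarrow> w x y \<and> odd_degree R x y"
    \<comment> \<open>A vertex of \<open>R\<close> is not on \<open>B\<close>, so \<open>w\<close>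
      has the same value at \<open>(x, y)\<close>, \<open>(x + 1, y)\<close> and
      \<open>(x, y + 1)\<close>. These are the points at which \<open>H\<close> and \<open>V\<close>
      evaluate \<open>w\<close> for the four edges at \<open>(x, y)\<close>, and the common value
      factors out of the xor.\<close>
    proof (cases "touches R x y")
      case True
      then have "\<not> touches B x y" using disjoint xy by blast
      then show ?thesis
        using w_right[OF xy] w_up[OF xy] unfolding H_def V_def odd_degree_def by blast
    next
      case False
      then show ?thesis unfolding H_def V_def odd_degree_def touches_def by blast
    qed
    also have "\<dots> \<longleftrightarrow> x = a \<and> y = q" using odd[OF xy] q(1)[of y] q(2) by auto
    finally show ?thesis .
  qed
  obtain T where "fmdef2 T \<and> (\<forall>x. \<not> T x \<zero>) \<and>
    (\<forall>x y. x \<preceq> ?N \<longrightarrow> y \<prec> ?N \<longrightarrow> (T x (y \<oplus> \<one>) \<longleftrightarrow> (T x y \<noteq> H x y)))"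
    using column_parity[OF defs(1), of ?N] by (rule exE)
  then have T: "fmdef2 T" "\<And>x. \<not> T x \<zero>"
    "\<And>x y. x \<preceq> ?N \<Longrightarrow> y \<prec> ?N \<Longrightarrow> T x (y \<oplus> \<one>) \<longleftrightarrow> (T x y \<noteq> H x y)"
    by simp_all
  have step: "(T x ?N \<noteq> T (x \<oplus> \<one>) ?N) \<longleftrightarrow> x = a" if x: "x \<preceq> n" for x
  proof -
    have "?N \<preceq> ?N \<longrightarrow> ((T x ?N \<noteq> T (x \<oplus> \<one>) ?N) \<longleftrightarrow> (V x ?N \<noteq> (x = a \<and> q \<prec> ?N)))"
    \<comment> \<open>The only odd vertex is \<open>(a, q)\<close>, so the parity of odd vertices
      below \<open>y\<close> is true just in column \<open>a\<close> and just above height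
      \<open>q\<close>.\<close>
    proof (rule column_sum[OF T defs(2), where od="\<lambda>y. x = a \<and> q \<prec> y"])
      show "\<not> V x \<zero>" by (simp add: V_def)
      show "fmdef (\<lambda>v. x = a \<and> q \<prec> S v)" if "tmdef S" for S
        by (intro def_intros that)
      show "\<not> (x = a \<and> q \<prec> \<zero>)" using no_lt_zero by blast
      show "x \<prec> ?N" using x by (rule less)
      show "(x = a \<and> q \<prec> y \<oplus> \<one>) \<longleftrightarrow>
          ((x = a \<and> q \<prec> y) \<noteq> (H x y \<noteq> (H (x \<oplus> \<one>) y \<noteq> (V x y \<noteq> V x (y \<oplus> \<one>)))))"
        if "y \<prec> ?N" for y
      proof -
        have "y \<preceq> n" by (rule le_iff_lt_succ[THEN iffD2, OF that])
        then show ?thesis unfolding sum[OF x \<open>y \<preceq> n\<close>] lt_succ_cases by auto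
      qed
    qed
    moreover have "\<not> V x ?N" using vedge_boundary[OF R] by (simp add: V_def)
    ultimately show ?thesis using less[OF qn] by simp
  qed
  have empty: "\<not> T x ?N" if "x \<preceq> ?N" "\<And>y. \<not> H x y" for x
    using column_parity_empty[OF T that, of ?N] by simp
  have "x \<preceq> ?N \<longrightarrow> (T x ?N \<longleftrightarrow> a \<prec> x)" for x
  proof (induction x rule: induction)
    case definable
    show ?case by (intro def_intros fmdef2D[OF T(1)])
  next
    case zero
    have "\<not> T \<zero> ?N" by (rule empty) (simp_all add: H_def)
    then show ?case using no_lt_zero by blast
  next
    case (succ x)
    show ?case
    proof
      assume "x \<oplus> \<one> \<preceq> ?N"
      then have x: "x \<preceq> n" by simp
      then have "T x ?N \<longleftrightarrow> a \<prec> x" using succ less[OF x] by simp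
      then show "T (x \<oplus> \<one>) ?N \<longleftrightarrow> a \<prec> x \<oplus> \<one>" using step[OF x] unfolding lt_succ_cases by auto
    qed
  qed
  then have "T ?N ?N" using less[OF a] by simp
  moreover have "\<not> T ?N ?N"
    by (rule empty) (simp_all add: H_def hedge_boundary[OF R])
  ultimately show False by blast
qed

section \<open>Evaluating the formula\<close>

lemma tmval_pair [simp]: "tmval M v f (pair s t) = pr (tmval M v f s) (tmval M v f t)"
  by (simp add: pair_def Two_def pr_def)

lemma sat_incident [simp]:
  "sat M v f (incident E e p) \<longleftrightarrow> inc (f E) (tmval M v f e) (tmval M v f p)"
  by (simp add: incident_def inc_def) (metis le_pr)

text \<open>This shows that the bound \<open>Len E\<close> in the degree formulas excludes no edge,
  so that they can be read with unbounded quantifiers.\<close>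

lemma inc_le_len: "inc E e p \<Longrightarrow> e \<preceq> len M E"
  unfolding inc_def using mem_lt_len by blast

lemma sat_deg_ge1 [simp]: "sat M v f (deg_ge1 E p) \<longleftrightarrow> (\<exists>e. inc (f E) e (tmval M v f p))"
  by (auto simp: deg_ge1_def intro: inc_le_len)

lemma sat_deg1: "sat M v f (deg1 E p) \<longleftrightarrow>
   (\<exists>e. inc (f E) e (tmval M v f p) \<and> (\<forall>e'. inc (f E) e' (tmval M v f p) \<longrightarrow> e' = e))"
  using inc_le_len by (simp add: deg1_def) blast

lemma sat_deg2: "sat M v f (deg2 E p) \<longleftrightarrow>
   (\<exists>e e'. e \<noteq> e' \<and> inc (f E) e (tmval M v f p) \<and> inc (f E) e' (tmval M v f p) \<and>
     (\<forall>e''. inc (f E) e'' (tmval M v f p) \<longrightarrow> e'' = e \<or> e'' = e'))"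
  using inc_le_len by (simp add: deg2_def) blast

lemma not_pr_lt_pred: "\<not> pr (x \<oplus> \<one>) y \<prec> pr x y" "\<not> pr x (y \<oplus> \<one>) \<prec> pr x y"
proof -
  have "x \<oplus> y \<prec> x \<oplus> \<one> \<oplus> y" "x \<oplus> y \<prec> x \<oplus> (y \<oplus> \<one>)"
    using lt_iff_succ_le by (simp_all add: succ_add add_succ)
  from this[THEN pr_strict_mono] show "\<not> pr (x \<oplus> \<one>) y \<prec> pr x y" "\<not> pr x (y \<oplus> \<one>) \<prec> pr x y"
    using le_antisym by blast+
qed

lemma edges_of_sat:
  assumes "sat M v f (edge_set t E)"
  shows "edges (tmval M v f t) (f E)"
  unfolding edges_def
proof (intro allI impI)
  let ?n = "tmval M v f t"
  fix e assume e: "mem M e (f E)"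
  then have "e \<preceq> len M (f E)" using mem_lt_len by blast
  then have "sat M (case_nat e v) f (is_edge (nlift t) (NVar 0))"
    using assms e by (simp add: edge_set_def)
  then obtain x y x' y' where xy: "e = pr (pr x y) (pr x' y')" "pr x y \<prec> pr x' y'"
    "x \<preceq> ?n" "y \<preceq> ?n" "x' \<preceq> ?n" "y' \<preceq> ?n"
    "x = x' \<and> (y = y' \<oplus> \<one> \<or> y' = y \<oplus> \<one>) \<or> y = y' \<and> (x = x' \<oplus> \<one> \<or> x' = x \<oplus> \<one>)"
    by (auto simp: is_edge_def adjacent_def differ_by_one_def Let_def)
  \<comment> \<open>Steps to the left or downwards decrease the code and are excluded by the order
    of the two ends, which leaves one code per edge.\<close>
  from xy(7) consider "x = x'" "y' = y \<oplus> \<one>" | "y = y'" "x' = x \<oplus> \<one>"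
    using xy(2) not_pr_lt_pred by blast
  then show "(\<exists>x y. x \<prec> ?n \<and> y \<preceq> ?n \<and> e = hcode x y) \<or> (\<exists>x y. x \<preceq> ?n \<and> y \<prec> ?n \<and> e = vcode x y)"
  proof cases
    case 1
    then have "x \<preceq> ?n \<and> y \<prec> ?n \<and> e = vcode x y"
      using xy lt_iff_succ_le[of y ?n] by (simp add: vcode_def)
    then show ?thesis by blast
  next
    case 2
    then have "x \<prec> ?n \<and> y \<preceq> ?n \<and> e = hcode x y"
      using xy lt_iff_succ_le[of x ?n] by (simp add: hcode_def)
    then show ?thesis by blast
  qed
qed

text \<open>The symmetric condition is normalised by letting \<open>b\<close> be the height of the
  lower point, whichever of the two it is. The upper point and the midpoint are then successors of
  it, without subtraction or halving.\<close>

lemma different_sides_coordinates: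
  assumes "sat M v f (different_sides t E p1 p2)"
  obtains a b where "a \<preceq> tmval M v f t" "b \<oplus> \<one> \<oplus> \<one> \<preceq> tmval M v f t"
    "tmval M v f p1 = pr a b \<and> tmval M v f p2 = pr a (b \<oplus> \<one> \<oplus> \<one>) \<or>
     tmval M v f p1 = pr a (b \<oplus> \<one> \<oplus> \<one>) \<and> tmval M v f p2 = pr a b"
    "\<nexists>e. inc (f E) e (pr a b)" "\<nexists>e. inc (f E) e (pr a (b \<oplus> \<one> \<oplus> \<one>))"
    "\<exists>e. inc (f E) e (pr a (b \<oplus> \<one>))"
proof -
  let ?n = "tmval M v f t"
  have "\<exists>a y1 y2 m. a \<preceq> ?n \<and> y1 \<preceq> ?n \<and> y2 \<preceq> ?n \<and>
      tmval M v f p1 = pr a y1 \<and> tmval M v f p2 = pr a y2 \<and>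
      (y1 = y2 \<oplus> (\<one> \<oplus> \<one>) \<or> y2 = y1 \<oplus> (\<one> \<oplus> \<one>)) \<and> m \<oplus> m = y1 \<oplus> y2 \<and>
      (\<nexists>e. inc (f E) e (tmval M v f p1)) \<and> (\<nexists>e. inc (f E) e (tmval M v f p2)) \<and>
      (\<exists>e. inc (f E) e (pr a m))"
    using assms
    by (simp add: different_sides_def Let_def deg0_def sat_deg2 Two_def two_mul) blast
  then obtain a y1 y2 m where h: "a \<preceq> ?n" "y1 \<preceq> ?n" "y2 \<preceq> ?n"
    "tmval M v f p1 = pr a y1" "tmval M v f p2 = pr a y2"
    "y1 = y2 \<oplus> \<one> \<oplus> \<one> \<or> y2 = y1 \<oplus> \<one> \<oplus> \<one>" "m \<oplus> m = y1 \<oplus> y2"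
    "\<nexists>e. inc (f E) e (pr a y1)" "\<nexists>e. inc (f E) e (pr a y2)" "\<exists>e. inc (f E) e (pr a m)"
    unfolding add_assoc[symmetric] by metis
  have mid: "m = y \<oplus> \<one>" if "m \<oplus> m = y \<oplus> (y \<oplus> \<one> \<oplus> \<one>)" for y
  proof -
    have "m \<oplus> m = (y \<oplus> \<one>) \<oplus> (y \<oplus> \<one>)" using that by (simp only: add_ac)
    then show ?thesis by (simp only: double_eq)
  qed
  show ?thesis using h(6)
  proof
    assume y: "y1 = y2 \<oplus> \<one> \<oplus> \<one>"
    then have "m = y2 \<oplus> \<one>" using h(7) by (intro mid) (simp only: add_comm)
    then show ?thesis using h y that[of a y2] by simp
  next
    assume y: "y2 = y1 \<oplus> \<one> \<oplus> \<one>"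
    then have "m = y1 \<oplus> \<one>" using h(7) by (intro mid) simp
    then show ?thesis using h y that[of a y1] by simp
  qed
qed

lemma even_degree_of_sat:
  assumes "edges n (f E)" "sat M v f (deg0 E (pair s t)) \<or> sat M v f (deg2 E (pair s t))"
  shows "\<not> odd_degree (f E) (tmval M v f s) (tmval M v f t)"
  using assms(2)
proof
  assume "sat M v f (deg0 E (pair s t))"
  then have "\<not> touches (f E) (tmval M v f s) (tmval M v f t)"
    by (simp add: deg0_def touches_iff[OF assms(1)])
  then show ?thesis by (simp add: touches_def odd_degree_def)
next
  assume "sat M v f (deg2 E (pair s t))"
  then obtain e e' where "e \<noteq> e'" "inc (f E) e (pr (tmval M v f s) (tmval M v f t))"
    "inc (f E) e' (pr (tmval M v f s) (tmval M v f t))"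
    "\<forall>e''. inc (f E) e'' (pr (tmval M v f s) (tmval M v f t)) \<longrightarrow> e'' = e \<or> e'' = e'"
    unfolding sat_deg2 by auto
  then show ?thesis using even_degree_of_deg2[OF assms(1)] by blast
qed

lemma sat_jordan_main: "sat M v f (jordan_main t p1 p2 B R)"
proof (rule ccontr)
  let ?n = "tmval M v f t"
  assume "\<not> ?thesis"
  then have B: "sat M v f (edge_set t B)" "sat M v f (curve t B)"
    and sides: "sat M v f (different_sides t B p1 p2)"
    and R: "sat M v f (edge_set t R)" "sat M v f (connects t R p1 p2)"
    and disjoint: "\<not> sat M v f (intersect t B R)"
    by (auto simp: jordan_main_def)
  note eB = edges_of_sat[OF B(1)] and eR = edges_of_sat[OF R(1)]
  from sides show False
  proof (rule different_sides_coordinates)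
    fix a b
    assume ab: "a \<preceq> ?n" "b \<oplus> \<one> \<oplus> \<one> \<preceq> ?n"
      "tmval M v f p1 = pr a b \<and> tmval M v f p2 = pr a (b \<oplus> \<one> \<oplus> \<one>) \<or>
       tmval M v f p1 = pr a (b \<oplus> \<one> \<oplus> \<one>) \<and> tmval M v f p2 = pr a b"
      "\<nexists>e. inc (f B) e (pr a b)" "\<nexists>e. inc (f B) e (pr a (b \<oplus> \<one> \<oplus> \<one>))"
      "\<exists>e. inc (f B) e (pr a (b \<oplus> \<one>))"
    have deg1: "odd_degree (f R) x y"
      if p: "sat M v f (deg1 R p)" "tmval M v f p = pr x y" for p x y
    proof -
      obtain e where "inc (f R) e (pr x y)" "\<forall>e'. inc (f R) e' (pr x y) \<longrightarrow> e' = e"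
        using p unfolding sat_deg1 by auto
      then show ?thesis using odd_degree_of_deg1[OF eR] by blast
    qed
    have ends: "odd_degree (f R) a b" "odd_degree (f R) a (b \<oplus> \<one> \<oplus> \<one>)"
      using deg1[of p1] deg1[of p2] R(2) ab(3) unfolding connects_def by auto
    show False
    proof (rule separation[OF eB eR])
      show "\<not> odd_degree (f B) x y" if "x \<preceq> ?n" "y \<preceq> ?n" for x y
      proof -
        have "sat M (case_nat y (case_nat x v)) f (deg0 B (pair (NVar 1) (NVar 0))) \<or>
            sat M (case_nat y (case_nat x v)) f (deg2 B (pair (NVar 1) (NVar 0)))"
          using B(2) that unfolding curve_def by simp
        from even_degree_of_sat[OF eB this] show ?thesis by simp
      qed
      show "odd_degree (f R) x y \<longleftrightarrow> x = a \<and> (y = b \<or> y = b \<oplus> \<one> \<oplus> \<one>)"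
        if xy: "x \<preceq> ?n" "y \<preceq> ?n" for x y
      proof (cases "x = a \<and> (y = b \<or> y = b \<oplus> \<one> \<oplus> \<one>)")
        case True
        then show ?thesis using ends by blast
      next
        case False
        then have "pr x y \<noteq> tmval M v f p1" "pr x y \<noteq> tmval M v f p2" using ab(3) by auto
        then have "sat M (case_nat y (case_nat x v)) f (deg0 R (pair (NVar 1) (NVar 0))) \<or>
            sat M (case_nat y (case_nat x v)) f (deg2 R (pair (NVar 1) (NVar 0)))"
          using R(2) xy unfolding connects_def by simp
        from even_degree_of_sat[OF eR this] False show ?thesis by simp
      qed
      show "\<not> (touches (f B) x y \<and> touches (f R) x y)" if "x \<preceq> ?n" "y \<preceq> ?n" for x y
        using disjoint that unfolding intersect_def touches_iff[OF eB] touches_iff[OF eR] by simp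
    qed (use ab in \<open>simp_all add: touches_iff[OF eB]\<close>)
  qed
qed

end

theorem mainTheorem1:
  "V0_2 \<turnstile> NAll (NAll (NAll (SAll (SAll
     (jordan_main (NVar 2) (NVar 1) (NVar 0) 1 0)))))"
proof (rule completeness)
  fix M :: "(nat, nat) struct" and v f
  assume "\<And>\<phi> v f. \<phi> \<in> V0_2 \<Longrightarrow> sat M v f \<phi>"
  then interpret V02_model M by unfold_locales
  show "sat M v f (NAll (NAll (NAll (SAll (SAll (jordan_main (NVar 2) (NVar 1) (NVar 0) 1 0))))))"
    by (simp add: sat_jordan_main)
qed (simp_all add: V0_2_def V0_def BASIC2_def Let_def)

end
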